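(* For every tree $T$, if $\mathrm{lmw}(T)=k$ then $k\le \mathrm{lmw}(T^2)\le 2k$. Moreover, both bounds are tight for every $k\ge 0$: for every integer $k\ge 0$ there exists a tree $T$ with $\mathrm{lmw}(T)=\mathrm{lmw}(T^2)=k$, and there exists a tree $T'$ with $\mathrm{lmw}(T')=k$ and $\mathrm{lmw}(T'^2)=2k$.
   Context: All graphs are finite and simple. For a graph $G$, its square $G^2$ is the graph on $V(G)$ in which two distinct vertices are adjacent iff their distance in $G$ is at most $2$. For disjoint $S,T\subseteq V(G)$, $G[S,T]$ denotes the bipartite graph on $S\cup T$ whose edges are exactly the edges of $G$ with one endpoint in $S$ and the other in $T$. $\mathrm{mim}(H)$ is the maximum number of edges in an induced matching of $H$. A linear layout of an $n$-vertex graph $G$ is a bijection $\sigma:V(G)\to\{1,\dots,n\}$; write $v_i=\sigma^{-1}(i)$ and $V_i^\sigma=\{v_1,\dots,v_i\}$, $\overline{V_i^\sigma}=V(G)\setminus V_i^\sigma$. The MIM-width of $G$ under $\sigma$ is $\mathrm{mw}(\sigma,G)=\max_{1\le i<n}\mathrm{mim}(G[V_i^\sigma,\overline{V_i^\sigma}])$ (equal to $0$ if $n\le 1$). The linear MIM-width $\mathrm{lmw}(G)$ is the minimum of $\mathrm{mw}(\sigma,G)$ over all linear layouts $\sigma$ of $G$. *)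

theory Defs
  imports Main
begin

definition simple_graph :: "'a set \<Rightarrow> 'a set set \<Rightarrow> bool" where
  "simple_graph V E \<longleftrightarrow> finite V \<and>
     (\<forall>e\<in>E. \<exists>u v. e = {u, v} \<and> u \<noteq> v \<and> u \<in> V \<and> v \<in> V)"

definition adj :: "'a set set \<Rightarrow> 'a \<Rightarrow> 'a \<Rightarrow> bool" where
  "adj E u v \<longleftrightarrow> {u, v} \<in> E"

definition connected_graph :: "'a set \<Rightarrow> 'a set set \<Rightarrow> bool" where
  "connected_graph V E \<longleftrightarrow>
     (\<forall>u\<in>V. \<forall>v\<in>V. (\<lambda>x y. adj E x y \<and> x \<in> V \<and> y \<in> V)\<^sup>*\<^sup>* u v)"

definition is_cycle :: "'a set \<Rightarrow> 'a set set \<Rightarrow> 'a list \<Rightarrow> bool" where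
  "is_cycle V E cs \<longleftrightarrow> length cs \<ge> 3 \<and> distinct cs \<and> set cs \<subseteq> V \<and>
     (\<forall>i. Suc i < length cs \<longrightarrow> adj E (cs ! i) (cs ! Suc i)) \<and>
     adj E (last cs) (hd cs)"

definition is_tree :: "'a set \<Rightarrow> 'a set set \<Rightarrow> bool" where
  "is_tree V E \<longleftrightarrow> simple_graph V E \<and> V \<noteq> {} \<and> connected_graph V E \<and>
     (\<nexists>cs. is_cycle V E cs)"

definition graph_square :: "'a set \<Rightarrow> 'a set set \<Rightarrow> 'a set set" where
  "graph_square V E = {{u, v} | u v. u \<in> V \<and> v \<in> V \<and> u \<noteq> v \<and>
      ({u, v} \<in> E \<or> (\<exists>w\<in>V. {u, w} \<in> E \<and> {w, v} \<in> E))}"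

text \<open>Edge set of the bipartite graph G[S,T]: edges with one endpoint in S and the
  other in T (S, T disjoint).\<close>
definition bip_edges :: "'a set set \<Rightarrow> 'a set \<Rightarrow> 'a set \<Rightarrow> 'a set set" where
  "bip_edges E S T = {e \<in> E. \<exists>u v. e = {u, v} \<and> u \<in> S \<and> v \<in> T}"

definition induced_matching :: "'a set set \<Rightarrow> 'a set set \<Rightarrow> bool" where
  "induced_matching EH M \<longleftrightarrow> M \<subseteq> EH \<and>
     (\<forall>e\<in>M. \<forall>f\<in>M. e \<noteq> f \<longrightarrow> e \<inter> f = {} \<and>
        \<not> (\<exists>g\<in>EH. g \<inter> e \<noteq> {} \<and> g \<inter> f \<noteq> {}))"

definition mim :: "'a set set \<Rightarrow> nat" where
  "mim EH = Max {card M | M. induced_matching EH M}"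

definition linear_layout :: "'a set \<Rightarrow> ('a \<Rightarrow> nat) \<Rightarrow> bool" where
  "linear_layout V \<sigma> \<longleftrightarrow> bij_betw \<sigma> V {1..card V}"

definition prefix_set :: "'a set \<Rightarrow> ('a \<Rightarrow> nat) \<Rightarrow> nat \<Rightarrow> 'a set" where
  "prefix_set V \<sigma> i = {v \<in> V. \<sigma> v \<le> i}"

definition mimw :: "'a set \<Rightarrow> 'a set set \<Rightarrow> ('a \<Rightarrow> nat) \<Rightarrow> nat" where
  "mimw V E \<sigma> = Max ({0} \<union>
     {mim (bip_edges E (prefix_set V \<sigma> i) (V - prefix_set V \<sigma> i)) | i.
        1 \<le> i \<and> i < card V})"

definition lmw :: "'a set \<Rightarrow> 'a set set \<Rightarrow> nat" where
  "lmw V E = Min {mimw V E \<sigma> | \<sigma>. linear_layout V \<sigma>}"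

end

theory Submission
  imports Defs "HOL-Library.Nat_Bijection"
begin

text \<open>
The upper bound holds cutwise for every graph: a matching edge of the square carries an edge
of the graph that crosses the cut, incident with its left or with its right end, and the more
frequent of the two kinds gives an induced matching of at least half the size.

The lower bound is an induction on the tree \<open>T\<close>, with \<open>T\<^sup>2\<close> of width at most \<open>k + 1\<close>. Call a
neighbour \<open>v\<close> of \<open>x\<close> heavy if some component of \<open>T - v\<close> that avoids \<open>x\<close> has a square of width more
than \<open>k\<close>. If \<open>x\<close> had three heavy neighbours, then at the median of the three cuts that realise
these widths, a path of \<open>T\<^sup>2\<close> connecting the other two components without using \<open>x\<close> would cross
the cut at distance at least three from the middle component and add one more matching edge. So
every vertex has at most two heavy neighbours, and layouts of the branches can be assembled along
a path of heavy vertices at the cost of a single edge more than the light components.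

Both extremal families are built by recursion. Joining three copies to a new vertex by paths of
length two raises both widths by one. Joining copies in two levels, three at each of three
neighbours of a centre, lets the median argument be applied twice in the square.
\<close>

section \<open>Cuts and layouts of relations\<close>

text \<open>Each edge is stored as an ordered pair, left end first. Disjointness of distinct edges
  follows from the second clause: a shared left end would turn \<open>R c d\<close> into
  \<open>R a d\<close>, a shared right end \<open>R a b\<close> into \<open>R a d\<close>. The
  clause ranges over both orders of two edges, so \<open>R c b\<close> is excluded as well.\<close>

definition cross_matching :: "('a \<Rightarrow> 'a \<Rightarrow> bool) \<Rightarrow> 'a set \<Rightarrow> 'a set \<Rightarrow> ('a \<times> 'a) set \<Rightarrow> bool" where
  "cross_matching R A B M \<longleftrightarrow>
     (\<forall>a b. (a, b) \<in> M \<longrightarrow> a \<in> A \<and> b \<in> B \<and> R a b) \<and>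
     (\<forall>a b c d. (a, b) \<in> M \<longrightarrow> (c, d) \<in> M \<longrightarrow> (a, b) \<noteq> (c, d) \<longrightarrow> \<not> R a d)"

definition cut_le :: "('a \<Rightarrow> 'a \<Rightarrow> bool) \<Rightarrow> 'a set \<Rightarrow> 'a set \<Rightarrow> nat \<Rightarrow> bool" where
  "cut_le R A B k \<longleftrightarrow> (\<forall>M. cross_matching R A B M \<longrightarrow> card M \<le> k)"

text \<open>Layouts are lists so that they can be concatenated, reversed and filtered. The two cuts
  with an empty side are included; they are harmless by \<open>cut_le_empty\<close>.\<close>

definition layout_le :: "('a \<Rightarrow> 'a \<Rightarrow> bool) \<Rightarrow> 'a list \<Rightarrow> nat \<Rightarrow> bool" where
  "layout_le R xs k \<longleftrightarrow> (\<forall>ys zs. xs = ys @ zs \<longrightarrow> cut_le R (set ys) (set zs) k)"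

definition lmw_le :: "('a \<Rightarrow> 'a \<Rightarrow> bool) \<Rightarrow> 'a set \<Rightarrow> nat \<Rightarrow> bool" where
  "lmw_le R V k \<longleftrightarrow> (\<exists>xs. distinct xs \<and> set xs = V \<and> layout_le R xs k)"

lemma cross_matchingD:
  assumes "cross_matching R A B M" "(a, b) \<in> M"
  shows "a \<in> A" "b \<in> B" "R a b"
  using assms by (auto simp: cross_matching_def)

lemma cross_matching_eq:
  assumes "cross_matching R A B M" "(a, b) \<in> M" "(c, d) \<in> M" "R a d \<or> R c b"
  shows "a = c \<and> b = d"
  using assms unfolding cross_matching_def by blast

lemma cross_matching_subset: "cross_matching R A B M \<Longrightarrow> N \<subseteq> M \<Longrightarrow> cross_matching R A B N"
  unfolding cross_matching_def by blast

lemma cross_matching_subset_times: "cross_matching R A B M \<Longrightarrow> M \<subseteq> A \<times> B"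
  unfolding cross_matching_def by auto

lemma cut_leI:
  assumes "\<And>M. cross_matching R A B M \<Longrightarrow> card M \<le> k"
  shows "cut_le R A B k"
  using assms by (auto simp: cut_le_def)

lemma cut_leD: "cut_le R A B k \<Longrightarrow> cross_matching R A B M \<Longrightarrow> card M \<le> k"
  by (auto simp: cut_le_def)

text \<open>Only crossing edges matter: \<open>A'\<close> and \<open>B'\<close> may have further
  vertices, as long as every edge between the two sets runs from \<open>A\<close> to
  \<open>B\<close>.\<close>

lemma cut_le_subset:
  assumes "cut_le R A B k" and "\<And>a b. a \<in> A' \<Longrightarrow> b \<in> B' \<Longrightarrow> R a b \<Longrightarrow> a \<in> A \<and> b \<in> B"
  shows "cut_le R A' B' k"
  using assms unfolding cut_le_def cross_matching_def by (metis (no_types, lifting))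

lemma cut_le_empty [simp]: "cut_le R {} B k" "cut_le R A {} k"
proof -
  have "M = {}" if "cross_matching R A B M" "A = {} \<or> B = {}" for A B M
    using cross_matching_subset_times[OF that(1)] that(2) by auto
  then show "cut_le R {} B k" "cut_le R A {} k"
    by (metis card.empty cut_leI le0)+
qed

lemma cross_matching_swap:
  assumes "symp R" and M: "cross_matching R B A M"
  shows "cross_matching R A B (prod.swap ` M)"
  unfolding cross_matching_def
proof (intro conjI allI impI)
  fix a b assume "(a, b) \<in> prod.swap ` M"
  then have "(b, a) \<in> M" by auto
  then show "a \<in> A" "b \<in> B" "R a b"
    using cross_matchingD[OF M, of b a] assms(1) by (auto dest: sympD)
next
  fix a b c d assume "(a, b) \<in> prod.swap ` M" "(c, d) \<in> prod.swap ` M" "(a, b) \<noteq> (c, d)"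
  then have "(b, a) \<in> M" "(d, c) \<in> M" "(b, a) \<noteq> (d, c)" by auto
  then show "\<not> R a d"
    using cross_matching_eq[OF M] assms(1) by (metis sympD)
qed

lemma cut_le_swap:
  assumes "symp R" "cut_le R A B k"
  shows "cut_le R B A k"
proof (rule cut_leI)
  fix M assume "cross_matching R B A M"
  then have "card (prod.swap ` M) \<le> k"
    using cut_leD[OF assms(2)] cross_matching_swap[OF assms(1)] by blast
  then show "card M \<le> k" by (simp add: card_image)
qed

text \<open>The source of every "plus one" in the constructions of layouts: the crossing edges that
  do not lie inside \<open>C\<close> conflict pairwise, so a matching contains at most one of them,
  and the rest of it is a matching inside \<open>C\<close>.\<close>

lemma cut_le_Suc:
  assumes "cut_le R (A \<inter> C) (B \<inter> C) k"
    and conf: "\<And>a b c d. \<lbrakk>a \<in> A; b \<in> B; R a b; \<not> (a \<in> C \<and> b \<in> C); c \<in> A; d \<in> B; R c d; \<not> (c \<in> C \<and> d \<in> C)\<rbrakk>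
       \<Longrightarrow> R a d \<or> R c b"
  shows "cut_le R A B (Suc k)"
proof (rule cut_leI)
  fix M assume M: "cross_matching R A B M"
  let ?N = "M \<inter> C \<times> C"
  have "cross_matching R (A \<inter> C) (B \<inter> C) ?N"
    using M unfolding cross_matching_def by blast
  then have N: "card ?N \<le> k" using assms(1) by (rule cut_leD[rotated])
  have eq: "p = q" if "p \<in> M - C \<times> C" "q \<in> M - C \<times> C" for p q
  proof -
    obtain a b c d where [simp]: "p = (a, b)" "q = (c, d)" by (metis surj_pair)
    have "R a d \<or> R c b"
      using that cross_matchingD[OF M, of a b] cross_matchingD[OF M, of c d]
      by (intro conf) auto
    then show ?thesis using cross_matching_eq[OF M, of a b c d] that by auto
  qed
  have "card (M - C \<times> C) \<le> Suc 0"
    using eq by (metis card_le_Suc0_iff_eq card.infinite le0)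
  moreover have "card M \<le> card ?N + card (M - C \<times> C)"
    by (metis card_Un_le Int_Diff_Un)
  ultimately show "card M \<le> Suc k" using N by simp
qed

lemma layout_leI:
  assumes "\<And>ys zs. xs = ys @ zs \<Longrightarrow> cut_le R (set ys) (set zs) k"
  shows "layout_le R xs k"
  using assms by (auto simp: layout_le_def)

text \<open>Every cut of a filtered list is the trace of a cut of the full list. This is how the
  width of a subset is compared with the width of the whole.\<close>

lemma filter_eq_appendD:
  "filter P xs = ys @ zs \<Longrightarrow> \<exists>us vs. xs = us @ vs \<and> ys = filter P us \<and> zs = filter P vs"
proof (induction xs arbitrary: ys)
  case (Cons x xs)
  show ?case
  proof (cases "P x \<and> ys \<noteq> []")
    case True
    then obtain ys' where ys: "ys = x # ys'" "filter P xs = ys' @ zs"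
      using Cons.prems by (cases ys) auto
    then obtain us vs where "xs = us @ vs" "ys' = filter P us" "zs = filter P vs"
      using Cons.IH by blast
    then show ?thesis using True ys by (intro exI[of _ "x # us"] exI[of _ vs]) simp
  next
    case False
    show ?thesis
    proof (cases "P x")
      case True
      then show ?thesis using False Cons.prems by (intro exI[of _ "[]"] exI[of _ "x # xs"]) simp
    next
      case F: False
      then obtain us vs where "xs = us @ vs" "ys = filter P us" "zs = filter P vs"
        using Cons.IH Cons.prems by force
      then show ?thesis using F by (intro exI[of _ "x # us"] exI[of _ vs]) simp
    qed
  qed
qed simp

lemma layout_le_filter:
  assumes "layout_le R xs k"
  shows "layout_le R (filter P xs) k"
proof (rule layout_leI)
  fix ys zs assume "filter P xs = ys @ zs"
  then obtain us vs where "xs = us @ vs" "ys = filter P us" "zs = filter P vs"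
    by (meson filter_eq_appendD)
  with assms have "cut_le R (set us) (set vs) k" "set ys \<subseteq> set us" "set zs \<subseteq> set vs"
    by (auto simp: layout_le_def)
  then show "cut_le R (set ys) (set zs) k" by (meson cut_le_subset subsetD)
qed

lemma lmw_le_subset:
  assumes "lmw_le R V k" "U \<subseteq> V"
  shows "lmw_le R U k"
proof -
  obtain xs where "distinct xs" "set xs = V" "layout_le R xs k"
    using assms(1) by (auto simp: lmw_le_def)
  then have "distinct (filter (\<lambda>x. x \<in> U) xs)" "set (filter (\<lambda>x. x \<in> U) xs) = U"
    "layout_le R (filter (\<lambda>x. x \<in> U) xs) k"
    using assms(2) by (auto simp: layout_le_filter)
  then show ?thesis unfolding lmw_le_def by blast
qed

lemma layout_le_rev:
  assumes "symp R" "layout_le R xs k"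
  shows "layout_le R (rev xs) k"
proof (rule layout_leI)
  fix ys zs assume "rev xs = ys @ zs"
  then have "xs = rev zs @ rev ys" by (metis rev_append rev_rev_ident)
  then have "cut_le R (set (rev zs)) (set (rev ys)) k" using assms(2) by (simp only: layout_le_def)
  then show "cut_le R (set ys) (set zs) k" using cut_le_swap[OF assms(1)] by simp
qed

lemma layout_le_Nil [simp]: "layout_le R [] k"
  by (auto simp: layout_le_def)

lemma layout_le_single [simp]: "layout_le R [x] k"
  by (auto simp: layout_le_def Cons_eq_append_conv)

text \<open>The last two premises allow an edge between the lists only from the last vertex of
  \<open>xs\<close> to the first of \<open>ys\<close>. Such an edge crosses no cut inside either
  list, so only the middle cut needs a separate bound.\<close>

lemma layout_le_append:
  assumes "layout_le R xs k" "layout_le R ys k"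
    and "cut_le R (set xs) (set ys) k"
    and "\<And>a b. a \<in> set (butlast xs) \<Longrightarrow> b \<in> set ys \<Longrightarrow> \<not> R a b"
    and "\<And>a b. a \<in> set xs \<Longrightarrow> b \<in> set (tl ys) \<Longrightarrow> \<not> R a b"
  shows "layout_le R (xs @ ys) k"
proof (rule layout_leI)
  fix as bs assume "xs @ ys = as @ bs"
  then obtain us where "xs = as @ us \<and> bs = us @ ys \<or> as = xs @ us \<and> ys = us @ bs"
    by (auto simp: append_eq_append_conv2)
  then consider (left) "xs = as @ us" "bs = us @ ys" "us \<noteq> []"
    | (right) "as = xs @ us" "ys = us @ bs" "us \<noteq> []" | (eq) "as = xs" "ys = bs"
    by fastforce
  then show "cut_le R (set as) (set bs) k"
  proof cases
    case left
    then have "cut_le R (set as) (set us) k" using assms(1) by (auto simp: layout_le_def)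
    moreover have "set as \<subseteq> set (butlast xs)" using left by (auto simp: butlast_append)
    ultimately show ?thesis using assms(4) left by (elim cut_le_subset) auto
  next
    case right
    then have "cut_le R (set us) (set bs) k" using assms(2) by (auto simp: layout_le_def)
    moreover have "set bs \<subseteq> set (tl ys)" using right by (cases us) auto
    ultimately show ?thesis using assms(5) right by (elim cut_le_subset) auto
  next
    case eq
    then show ?thesis using assms(3) by simp
  qed
qed

lemma lmw_le_empty [simp]: "lmw_le R {} k"
  unfolding lmw_le_def by (rule exI[of _ "[]"]) simp

lemma lmw_le_Un:
  assumes "lmw_le R U k" "lmw_le R W k" "U \<inter> W = {}"
    and "\<And>a b. a \<in> U \<Longrightarrow> b \<in> W \<Longrightarrow> \<not> R a b"
  shows "lmw_le R (U \<union> W) k"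
proof -
  obtain xs ys where xs: "distinct xs" "set xs = U" "layout_le R xs k"
    and ys: "distinct ys" "set ys = W" "layout_le R ys k"
    using assms(1,2) by (auto simp: lmw_le_def)
  have "cut_le R U W k" using cut_le_subset[of R "{}" "{}"] assms(4) by fastforce
  moreover have "set (tl ys) \<subseteq> set ys" by (cases ys) auto
  ultimately have "layout_le R (xs @ ys) k"
    using xs ys assms(4) by (intro layout_le_append) (auto dest: in_set_butlastD)
  then show ?thesis
    using xs ys assms(3) unfolding lmw_le_def by (intro exI[of _ "xs @ ys"]) auto
qed

lemma lmw_le_UN:
  assumes "finite I" "\<And>i. i \<in> I \<Longrightarrow> lmw_le R (U i) k"
    and "\<And>i j. i \<in> I \<Longrightarrow> j \<in> I \<Longrightarrow> i \<noteq> j \<Longrightarrow> U i \<inter> U j = {}"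
    and "\<And>i j a b. i \<in> I \<Longrightarrow> j \<in> I \<Longrightarrow> i \<noteq> j \<Longrightarrow> a \<in> U i \<Longrightarrow> b \<in> U j \<Longrightarrow> \<not> R a b"
  shows "lmw_le R (\<Union>i\<in>I. U i) k"
  using assms
proof (induction I rule: finite_induct)
  case empty
  then show ?case by simp
next
  case (insert i I)
  have "lmw_le R (U i \<union> (\<Union>i\<in>I. U i)) k"
  proof (rule lmw_le_Un)
    show "lmw_le R (\<Union>i\<in>I. U i) k"
      by (rule insert.IH; use insert.prems in \<open>meson insertI2\<close>)
    show "U i \<inter> (\<Union>i\<in>I. U i) = {}" using insert by blast
    show "\<not> R a b" if "a \<in> U i" "b \<in> (\<Union>i\<in>I. U i)" for a b
      using that insert.prems(3)[of i _ a b] insert.hyps(2) by blast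
  qed (use insert in auto)
  then show ?case by simp
qed

lemma lmw_le_map:
  assumes "lmw_le R V k" "inj_on f V"
    and "\<And>x y. x \<in> V \<Longrightarrow> y \<in> V \<Longrightarrow> R' (f x) (f y) \<longleftrightarrow> R x y"
  shows "lmw_le R' (f ` V) k"
proof -
  obtain xs where xs: "distinct xs" "set xs = V" "layout_le R xs k"
    using assms(1) by (auto simp: lmw_le_def)
  have "layout_le R' (map f xs) k"
  proof (rule layout_leI, rule cut_leI)
    fix ys zs M assume split: "map f xs = ys @ zs" and M: "cross_matching R' (set ys) (set zs) M"
    obtain us vs where uv: "xs = us @ vs" "ys = map f us" "zs = map f vs"
      using split by (auto simp: map_eq_append_conv)
    \<comment> \<open>The preimage of \<open>M\<close> across the corresponding cut of
      \<open>xs\<close>; injectivity on \<open>V\<close> preserves its size.\<close>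
    define N where "N = {(a, b). a \<in> set us \<and> b \<in> set vs \<and> (f a, f b) \<in> M}"
    have MN: "M = map_prod f f ` N"
    proof (intro equalityI subsetI)
      fix p assume p: "p \<in> M"
      obtain a b where [simp]: "p = (a, b)" by (cases p)
      have "a \<in> f ` set us" "b \<in> f ` set vs" using cross_matchingD[OF M, of a b] p uv by auto
      then show "p \<in> map_prod f f ` N" using p unfolding N_def by fastforce
    qed (auto simp: N_def)
    have "inj_on (map_prod f f) (V \<times> V)"
      using assms(2) by (auto simp: inj_on_def)
    moreover have "N \<subseteq> V \<times> V" using xs uv by (auto simp: N_def)
    ultimately have card: "card M = card N" by (metis MN card_image inj_on_subset)
    have sub: "set us \<subseteq> V" "set vs \<subseteq> V" using xs uv by auto
    have "cross_matching R (set us) (set vs) N"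
      unfolding cross_matching_def
    proof (intro conjI allI impI)
      fix a b assume ab: "(a, b) \<in> N"
      then show "a \<in> set us" "b \<in> set vs" by (auto simp: N_def)
      then show "R a b" using ab cross_matchingD(3)[OF M, of "f a" "f b"] assms(3) sub
        by (auto simp: N_def)
    next
      fix a b c d assume *: "(a, b) \<in> N" "(c, d) \<in> N" "(a, b) \<noteq> (c, d)"
      then have "(f a, f b) \<noteq> (f c, f d)"
        using assms(2) sub by (auto simp: N_def inj_on_def)
      then show "\<not> R a d"
        using * cross_matching_eq[OF M, of "f a" "f b" "f c" "f d"] assms(3) sub by (auto simp: N_def)
    qed
    moreover have "cut_le R (set us) (set vs) k" using xs uv by (auto simp: layout_le_def)
    ultimately show "card M \<le> k" using card cut_leD by metis
  qed
  then show ?thesis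
    using xs assms(2) unfolding lmw_le_def by (intro exI[of _ "map f xs"]) (auto simp: distinct_map)
qed

lemma lmw_le_map_iff:
  assumes "inj_on f V" "\<And>x y. x \<in> V \<Longrightarrow> y \<in> V \<Longrightarrow> R' (f x) (f y) \<longleftrightarrow> R x y"
  shows "lmw_le R' (f ` V) k \<longleftrightarrow> lmw_le R V k"
proof
  assume "lmw_le R' (f ` V) k"
  then have "lmw_le R (inv_into V f ` f ` V) k"
    using assms by (intro lmw_le_map[of R']) (auto simp: inj_on_inv_into)
  then show "lmw_le R V k" using assms(1) by (simp add: inv_into_image_cancel)
next
  assume "lmw_le R V k"
  then show "lmw_le R' (f ` V) k" using assms by (rule lmw_le_map)
qed

section \<open>MIM-width and squares\<close>

lemma symp_adj: "symp (adj E)"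
  by (auto simp: symp_def adj_def insert_commute)

lemma simple_graph_adj:
  assumes "simple_graph V E" "adj E u v"
  shows "u \<in> V" "v \<in> V" "u \<noteq> v"
proof -
  have "{u, v} \<in> E" using assms(2) by (simp add: adj_def)
  then obtain a b where "{u, v} = {a, b}" "a \<noteq> b" "a \<in> V" "b \<in> V"
    using assms(1) by (metis simple_graph_def)
  then show "u \<in> V" "v \<in> V" "u \<noteq> v" by (auto simp: doubleton_eq_iff)
qed

lemma simple_graph_finite:
  assumes "simple_graph V E"
  shows "finite V" "finite E"
proof -
  show "finite V" using assms by (simp add: simple_graph_def)
  have "E \<subseteq> Pow V" using assms by (fastforce simp: simple_graph_def)
  then show "finite E" using \<open>finite V\<close> by (meson finite_Pow_iff finite_subset)
qed

lemma mim_le_iff: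
  assumes "finite EH"
  shows "mim EH \<le> k \<longleftrightarrow> (\<forall>M. induced_matching EH M \<longrightarrow> card M \<le> k)"
proof -
  have "{card M |M. induced_matching EH M} \<subseteq> card ` Pow EH"
    by (auto simp: induced_matching_def)
  then have "finite {card M |M. induced_matching EH M}"
    using assms by (meson finite_Pow_iff finite_imageI finite_subset)
  moreover have "induced_matching EH {}" by (simp add: induced_matching_def)
  ultimately show ?thesis unfolding mim_def by (subst Max_le_iff) blast+
qed

text \<open>Since the sides are disjoint, \<open>(a, b)\<close> can be recovered from
  \<open>{a, b}\<close>. Ordered matchings across the cut therefore correspond to induced matchings
  of the bipartite graph of the same size.\<close>

lemma mim_bip_edges_le_iff:
  assumes "finite E" "A \<inter> B = {}"
  shows "mim (bip_edges E A B) \<le> k \<longleftrightarrow> cut_le (adj E) A B k"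
proof -
  define ed where "ed = (\<lambda>(a :: 'a, b). {a, b})"
  have fin: "finite (bip_edges E A B)" using assms(1) by (simp add: bip_edges_def)
  have inj: "inj_on ed (A \<times> B)"
    using assms(2) by (auto simp: inj_on_def ed_def doubleton_eq_iff)
  have bip: "{a, b} \<in> bip_edges E A B \<longleftrightarrow> adj E a b" if "a \<in> A" "b \<in> B" for a b
    using that by (auto simp: bip_edges_def adj_def)
  have bipE: "\<exists>a b. e = {a, b} \<and> a \<in> A \<and> b \<in> B \<and> adj E a b" if "e \<in> bip_edges E A B" for e
    using that by (auto simp: bip_edges_def adj_def)
  have 1: "induced_matching (bip_edges E A B) (ed ` N)" if N: "cross_matching (adj E) A B N" for N
    unfolding induced_matching_def
  proof (intro conjI ballI impI)
    show "ed ` N \<subseteq> bip_edges E A B"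
      using cross_matchingD[OF N] bip by (auto simp: ed_def)
    fix e f assume "e \<in> ed ` N" "f \<in> ed ` N" "e \<noteq> f"
    then obtain a b c d where ef: "e = {a, b}" "f = {c, d}" "(a, b) \<in> N" "(c, d) \<in> N" "(a, b) \<noteq> (c, d)"
      by (auto simp: ed_def)
    have AB: "a \<in> A" "b \<in> B" "c \<in> A" "d \<in> B" "adj E a b" "adj E c d"
      using cross_matchingD[OF N] ef by auto
    have no: "\<not> adj E a d" "\<not> adj E c b" using N ef unfolding cross_matching_def by blast+
    have "a \<noteq> d" "c \<noteq> b" using AB(1-4) assms(2) by blast+
    moreover have "a \<noteq> c" "b \<noteq> d" using AB(5,6) no by blast+
    ultimately have neq: "a \<noteq> d" "c \<noteq> b" "a \<noteq> c" "b \<noteq> d" by blast+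
    then show "e \<inter> f = {}" unfolding ef(1,2) by blast
    show "\<not> (\<exists>g\<in>bip_edges E A B. g \<inter> e \<noteq> {} \<and> g \<inter> f \<noteq> {})"
    proof
      assume "\<exists>g\<in>bip_edges E A B. g \<inter> e \<noteq> {} \<and> g \<inter> f \<noteq> {}"
      then obtain g where g: "g \<in> bip_edges E A B" "g \<inter> e \<noteq> {}" "g \<inter> f \<noteq> {}" by (elim bexE conjE)
      then obtain u v where uv: "u \<in> A" "v \<in> B" "adj E u v" "{u, v} \<inter> e \<noteq> {}" "{u, v} \<inter> f \<noteq> {}"
        using bipE[OF g(1)] by metis
      moreover have "u \<noteq> b" "v \<noteq> a" "u \<noteq> d" "v \<noteq> c" using AB(1-4) assms(2) uv(1,2) by blast+
      ultimately have "u = a \<or> v = b" "u = c \<or> v = d" unfolding ef(1,2) by blast+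
      then show False using uv(3) no neq by blast
    qed
  qed
  have 2: "\<exists>N. cross_matching (adj E) A B N \<and> M = ed ` N" if M: "induced_matching (bip_edges E A B) M" for M
  proof (intro exI conjI)
    let ?N = "{(a, b). a \<in> A \<and> b \<in> B \<and> {a, b} \<in> M}"
    have sub: "M \<subseteq> bip_edges E A B" using M by (simp add: induced_matching_def)
    show "M = ed ` ?N"
    proof (intro equalityI subsetI)
      fix e assume e: "e \<in> M"
      then obtain a b where "e = {a, b}" "a \<in> A" "b \<in> B" using sub bipE by blast
      then show "e \<in> ed ` ?N" using e by (auto simp: ed_def intro!: image_eqI[of _ _ "(a, b)"])
    qed (auto simp: ed_def)
    show "cross_matching (adj E) A B ?N"
      unfolding cross_matching_def
    proof (intro conjI allI impI)
      fix a b assume "(a, b) \<in> ?N"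
      then have ab: "a \<in> A" "b \<in> B" "{a, b} \<in> bip_edges E A B" using sub by blast+
      then show "a \<in> A" "b \<in> B" "adj E a b" using bip by blast+
    next
      fix a b c d assume *: "(a, b) \<in> ?N" "(c, d) \<in> ?N" "(a, b) \<noteq> (c, d)"
      then have in_sets: "a \<in> A" "b \<in> B" "c \<in> A" "d \<in> B" "{a, b} \<in> M" "{c, d} \<in> M" by simp_all
      have "b \<noteq> c" using in_sets(2,3) assms(2) by blast
      then have "{a, b} \<noteq> {c, d}" using *(3) by (auto simp: doubleton_eq_iff)
      then have "\<not> (\<exists>g\<in>bip_edges E A B. g \<inter> {a, b} \<noteq> {} \<and> g \<inter> {c, d} \<noteq> {})"
        using M in_sets(5,6) unfolding induced_matching_def by (metis (no_types, lifting))
      moreover have "{a, d} \<inter> {a, b} \<noteq> {}" "{a, d} \<inter> {c, d} \<noteq> {}" by simp_all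
      ultimately have "{a, d} \<notin> bip_edges E A B" by metis
      then show "\<not> adj E a d" using bip[OF in_sets(1,4)] by blast
    qed
  qed
  have card: "card (ed ` N) = card N" if "cross_matching (adj E) A B N" for N
    using cross_matching_subset_times[OF that] inj by (meson card_image inj_on_subset)
  show ?thesis
    unfolding mim_le_iff[OF fin] cut_le_def
  proof (intro iffI allI impI)
    fix N assume "\<forall>M. induced_matching (bip_edges E A B) M \<longrightarrow> card M \<le> k" and N: "cross_matching (adj E) A B N"
    then have "card (ed ` N) \<le> k" using 1 by blast
    then show "card N \<le> k" using card[OF N] by simp
  next
    fix M assume *: "\<forall>N. cross_matching (adj E) A B N \<longrightarrow> card N \<le> k" "induced_matching (bip_edges E A B) M"
    then obtain N where "cross_matching (adj E) A B N" "M = ed ` N" using 2 by blast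
    then show "card M \<le> k" using card * by simp
  qed
qed

lemma mimw_le_iff:
  assumes "simple_graph V E"
  shows "mimw V E \<sigma> \<le> k \<longleftrightarrow>
    (\<forall>i. 1 \<le> i \<and> i < card V \<longrightarrow> cut_le (adj E) (prefix_set V \<sigma> i) (V - prefix_set V \<sigma> i) k)"
proof -
  let ?m = "\<lambda>i. mim (bip_edges E (prefix_set V \<sigma> i) (V - prefix_set V \<sigma> i))"
  have "{?m i |i. 1 \<le> i \<and> i < card V} = ?m ` {1..<card V}" by auto
  then have "mimw V E \<sigma> \<le> k \<longleftrightarrow> (\<forall>i\<in>{1..<card V}. ?m i \<le> k)"
    unfolding mimw_def by (subst Max_le_iff) auto
  also have "\<dots> \<longleftrightarrow> (\<forall>i. 1 \<le> i \<and> i < card V \<longrightarrow>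
      cut_le (adj E) (prefix_set V \<sigma> i) (V - prefix_set V \<sigma> i) k)"
    using simple_graph_finite[OF assms] by (subst mim_bip_edges_le_iff) auto
  finally show ?thesis .
qed

section \<open>Linear layouts as lists, and linear MIM-width in terms of them\<close>

lemma layout_list_of_linear_layout:
  assumes "finite V" "linear_layout V \<sigma>"
  obtains xs where "distinct xs" "set xs = V" "\<And>i. set (take i xs) = prefix_set V \<sigma> i"
proof
  define xs where "xs = map (inv_into V \<sigma>) [1..<Suc (card V)]"
  have bij: "bij_betw \<sigma> V {1..card V}" using assms(2) by (simp add: linear_layout_def)
  have ran: "set [1..<Suc (card V)] = {1..card V}" by auto
  have bij': "bij_betw (inv_into V \<sigma>) {1..card V} V" using bij by (rule bij_betw_inv_into)
  show "distinct xs" unfolding xs_def distinct_map ran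
    using bij' by (auto simp: bij_betw_def)
  show V: "set xs = V" unfolding xs_def set_map ran
    using bij' by (auto simp: bij_betw_def)
  fix i
  have "set (take i [1..<Suc (card V)]) = {1..min i (card V)}"
    by (cases "i \<le> card V") (auto simp: min_def simp del: upt_Suc)
  then have "set (take i xs) = inv_into V \<sigma> ` {1..min i (card V)}"
    unfolding xs_def take_map set_map by simp
  also have "\<dots> = prefix_set V \<sigma> i"
  proof (intro equalityI subsetI)
    fix v assume "v \<in> inv_into V \<sigma> ` {1..min i (card V)}"
    then obtain j where j: "v = inv_into V \<sigma> j" "j \<in> {1..card V}" "j \<le> i" by auto
    then have "v \<in> V" "\<sigma> v = j"
      using bij' bij_betwE bij_betw_inv_into_right[OF bij] by fastforce+
    then show "v \<in> prefix_set V \<sigma> i" using j by (simp add: prefix_set_def)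
  next
    fix v assume "v \<in> prefix_set V \<sigma> i"
    then have v: "v \<in> V" "\<sigma> v \<le> i" by (auto simp: prefix_set_def)
    then have "\<sigma> v \<in> {1..card V}" "inv_into V \<sigma> (\<sigma> v) = v"
      using bij by (auto simp: bij_betw_def)
    then show "v \<in> inv_into V \<sigma> ` {1..min i (card V)}" using v by (metis (full_types) atLeastAtMost_iff imageI min.boundedI)
  qed
  finally show "set (take i xs) = prefix_set V \<sigma> i" .
qed

lemma linear_layout_of_list:
  assumes "distinct xs" "set xs = V"
  obtains \<sigma> where "linear_layout V \<sigma>" "\<And>i. set (take i xs) = prefix_set V \<sigma> i"
proof
  let ?n = "length xs"
  define pos where "pos = inv_into {..<?n} ((!) xs)"
  have bij: "bij_betw ((!) xs) {..<?n} V" using bij_betw_nth[OF assms(1)] assms(2) by auto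
  have n: "card V = ?n" using assms distinct_card by fastforce
  have pos: "bij_betw pos V {..<?n}" unfolding pos_def using bij by (rule bij_betw_inv_into)
  have "bij_betw Suc {..<?n} {1..card V}"
    unfolding n by (rule bij_betw_byWitness[of _ "\<lambda>i. i - 1"]) auto
  then show "linear_layout V (Suc \<circ> pos)"
    unfolding linear_layout_def using pos by (rule bij_betw_trans[rotated])
  fix i
  have nth_pos: "xs ! pos v = v" "pos v < ?n" if "v \<in> V" for v
    using that bij_betw_inv_into_right[OF bij] pos by (auto simp: pos_def bij_betw_def)
  have pos_nth: "pos (xs ! j) = j" if "j < ?n" for j
    using that bij_betw_inv_into_left[OF bij] by (simp add: pos_def)
  show "set (take i xs) = prefix_set V (Suc \<circ> pos) i"
  proof (intro equalityI subsetI)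
    fix v assume "v \<in> set (take i xs)"
    then obtain j where "j < i" "j < ?n" "v = xs ! j" by (auto simp: in_set_conv_nth)
    then show "v \<in> prefix_set V (Suc \<circ> pos) i" using assms(2) by (auto simp: prefix_set_def pos_nth)
  next
    fix v assume "v \<in> prefix_set V (Suc \<circ> pos) i"
    then have "v \<in> V" "pos v < i" by (auto simp: prefix_set_def)
    then show "v \<in> set (take i xs)" using nth_pos[of v] by (auto simp: in_set_conv_nth)
  qed
qed

lemma layout_le_take:
  assumes "distinct xs" "set xs = V"
  shows "layout_le R xs k \<longleftrightarrow>
    (\<forall>i. 1 \<le> i \<and> i < card V \<longrightarrow> cut_le R (set (take i xs)) (V - set (take i xs)) k)"
proof -
  have n: "card V = length xs" using assms distinct_card by fastforce
  have diff: "V - set (take i xs) = set (drop i xs)" for i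
  proof -
    have "set (take i xs) \<union> set (drop i xs) = V"
      using assms(2) by (metis append_take_drop_id set_append)
    then show ?thesis using set_take_disj_set_drop_if_distinct[OF assms(1), of i i] by blast
  qed
  show ?thesis unfolding diff
  proof
    assume "layout_le R xs k"
    then show "\<forall>i. 1 \<le> i \<and> i < card V \<longrightarrow> cut_le R (set (take i xs)) (set (drop i xs)) k"
      unfolding layout_le_def by (metis append_take_drop_id)
  next
    assume cuts: "\<forall>i. 1 \<le> i \<and> i < card V \<longrightarrow> cut_le R (set (take i xs)) (set (drop i xs)) k"
    show "layout_le R xs k"
    proof (rule layout_leI)
      fix ys zs assume xs: "xs = ys @ zs"
      show "cut_le R (set ys) (set zs) k"
      proof (cases "ys = [] \<or> zs = []")
        case True
        then show ?thesis by auto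
      next
        case False
        then have "1 \<le> length ys \<and> length ys < card V" unfolding n xs by (auto simp: Suc_le_eq)
        then show ?thesis using cuts xs by (metis append_eq_conv_conj)
      qed
    qed
  qed
qed

theorem lmw_le_iff:
  assumes "simple_graph V E"
  shows "lmw V E \<le> k \<longleftrightarrow> lmw_le (adj E) V k"
proof -
  note fin = simple_graph_finite[OF assms]
  \<comment> \<open>Layouts are unconstrained outside \<open>V\<close>, so there may be infinitely
    many of them. The uniform bound \<open>card E\<close> makes the set of their widths finite,
    which gives \<open>Min\<close> its meaning.\<close>
  have "mimw V E \<sigma> \<le> card E" for \<sigma>
    unfolding mimw_le_iff[OF assms]
  proof (intro allI impI)
    fix i
    have "card M \<le> card E" if "induced_matching (bip_edges E A B) M" for M and A B :: "'a set"
      using that fin(2) by (auto simp: induced_matching_def bip_edges_def intro!: card_mono)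
    then have "mim (bip_edges E A B) \<le> card E" for A B
      by (subst mim_le_iff) (auto simp: bip_edges_def fin(2))
    then show "cut_le (adj E) (prefix_set V \<sigma> i) (V - prefix_set V \<sigma> i) (card E)"
      using mim_bip_edges_le_iff[OF fin(2)] by (metis Diff_disjoint)
  qed
  then have "{mimw V E \<sigma> |\<sigma>. linear_layout V \<sigma>} \<subseteq> {..card E}" by auto
  then have finm: "finite {mimw V E \<sigma> |\<sigma>. linear_layout V \<sigma>}" by (rule finite_subset) simp
  obtain xs where "distinct xs" "set xs = V" using fin(1) finite_distinct_list by metis
  then obtain \<sigma> where "linear_layout V \<sigma>" by (rule linear_layout_of_list) (rule that)
  then have "{mimw V E \<sigma> |\<sigma>. linear_layout V \<sigma>} \<noteq> {}" by auto
  then have "lmw V E \<le> k \<longleftrightarrow> (\<exists>\<sigma>. linear_layout V \<sigma> \<and> mimw V E \<sigma> \<le> k)"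
    unfolding lmw_def using finm by (subst Min_le_iff) auto
  also have "\<dots> \<longleftrightarrow> lmw_le (adj E) V k"
  proof
    assume "\<exists>\<sigma>. linear_layout V \<sigma> \<and> mimw V E \<sigma> \<le> k"
    then obtain \<sigma> where s: "linear_layout V \<sigma>" "mimw V E \<sigma> \<le> k" by blast
    obtain xs where xs: "distinct xs" "set xs = V" "\<And>i. set (take i xs) = prefix_set V \<sigma> i"
      using layout_list_of_linear_layout[OF fin(1) s(1)] by blast
    then have "layout_le (adj E) xs k"
      using s(2) unfolding mimw_le_iff[OF assms] layout_le_take[OF xs(1,2)] by simp
    then show "lmw_le (adj E) V k" using xs(1,2) unfolding lmw_le_def by blast
  next
    assume "lmw_le (adj E) V k"
    then obtain xs where xs: "distinct xs" "set xs = V" "layout_le (adj E) xs k"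
      by (auto simp: lmw_le_def)
    obtain \<sigma> where s: "linear_layout V \<sigma>" "\<And>i. set (take i xs) = prefix_set V \<sigma> i"
      using linear_layout_of_list[OF xs(1,2)] by blast
    then have "mimw V E \<sigma> \<le> k"
      using xs(3) unfolding mimw_le_iff[OF assms] layout_le_take[OF xs(1,2)] by simp
    then show "\<exists>\<sigma>. linear_layout V \<sigma> \<and> mimw V E \<sigma> \<le> k" using s(1) by blast
  qed
  finally show ?thesis .
qed

section \<open>Squares of relations and the factor-two upper bound\<close>

definition square :: "('a \<Rightarrow> 'a \<Rightarrow> bool) \<Rightarrow> 'a \<Rightarrow> 'a \<Rightarrow> bool" where
  "square R u v \<longleftrightarrow> u \<noteq> v \<and> (R u v \<or> (\<exists>w. R u w \<and> R w v))"

lemma symp_square: "symp R \<Longrightarrow> symp (square R)"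
  unfolding symp_def square_def by blast

lemma simple_graph_square: "finite V \<Longrightarrow> simple_graph V (graph_square V E)"
  unfolding simple_graph_def graph_square_def by blast

lemma adj_graph_square:
  assumes "simple_graph V E"
  shows "adj (graph_square V E) = square (adj E)"
proof (intro ext iffI)
  fix u v assume "adj (graph_square V E) u v"
  then obtain a b where ab: "{u, v} = {a, b}" "a \<noteq> b" "{a, b} \<in> E \<or> (\<exists>w\<in>V. {a, w} \<in> E \<and> {w, b} \<in> E)"
    unfolding adj_def graph_square_def by blast
  then have "square (adj E) a b" by (auto simp: square_def adj_def)
  moreover have "u = a \<and> v = b \<or> u = b \<and> v = a" using ab by (auto simp: doubleton_eq_iff)
  ultimately show "square (adj E) u v"
    using symp_square[OF symp_adj] by (metis sympD)
next
  fix u v assume *: "square (adj E) u v"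
  then have "u \<in> V" "v \<in> V" using simple_graph_adj[OF assms] by (auto simp: square_def)
  then show "adj (graph_square V E) u v"
    using * simple_graph_adj[OF assms] unfolding square_def adj_def graph_square_def by blast
qed

text \<open>Replace each \<open>(a, b)\<close> by the crossing edge from \<open>a\<close> to its
  neighbour \<open>w\<close> on the way to \<open>b\<close>. If \<open>a\<close> were adjacent to
  the replacement belonging to another edge \<open>(c, d)\<close>, then \<open>a\<close> would be
  within distance two of \<open>d\<close>, against inducedness in the square.\<close>

lemma card_le_half_cross_matching_square:
  assumes M: "cross_matching (square R) A B M" and "A \<inter> B = {}" "cut_le R A B k"
    and w: "\<And>a b. (a, b) \<in> M \<Longrightarrow> \<exists>w\<in>B. R a w \<and> (w = b \<or> R w b)"
  shows "card M \<le> k"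
proof -
  obtain f where f: "f (a, b) \<in> B" "R a (f (a, b))" "f (a, b) = b \<or> R (f (a, b)) b"
    if "(a, b) \<in> M" for a b
    using w by (metis case_prod_conv)
  have eq: "(a, b) = (c, d)" if "(a, b) \<in> M" "(c, d) \<in> M" "R a (f (c, d))" for a b c d
  proof -
    have "a \<noteq> d" using cross_matchingD[OF M that(1)] cross_matchingD[OF M that(2)] assms(2) by auto
    then have "square R a d" using f[OF that(2)] that(3) by (auto simp: square_def)
    then show ?thesis using cross_matching_eq[OF M that(1,2)] by simp
  qed
  let ?g = "\<lambda>(a, b). (a, f (a, b))"
  have "inj_on ?g M"
  proof (rule inj_onI)
    fix p q assume "p \<in> M" "q \<in> M" "?g p = ?g q"
    moreover obtain a b c d where "p = (a, b)" "q = (c, d)" by (metis surj_pair)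
    ultimately have *: "(a, b) \<in> M" "(c, d) \<in> M" "f (a, b) = f (c, d)" and pq: "p = (a, b)" "q = (c, d)"
      by auto
    then have "R a (f (c, d))" using f(2) by metis
    then show "p = q" using eq *(1,2) pq by blast
  qed
  then have "card (?g ` M) = card M" by (rule card_image)
  moreover have "cross_matching R A B (?g ` M)"
    unfolding cross_matching_def
  proof (intro conjI allI impI)
    fix a v assume "(a, v) \<in> ?g ` M"
    then show "a \<in> A" "v \<in> B" "R a v" using f cross_matchingD[OF M] by auto
  next
    fix a v c u assume *: "(a, v) \<in> ?g ` M" "(c, u) \<in> ?g ` M" "(a, v) \<noteq> (c, u)"
    then obtain b d where "(a, b) \<in> M" "(c, d) \<in> M" "v = f (a, b)" "u = f (c, d)" by auto
    then show "\<not> R a u" using eq * by blast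
  qed
  ultimately show ?thesis using cut_leD[OF assms(3), of "?g ` M"] by simp
qed

text \<open>By \<open>closed\<close> the midpoint of a crossing edge of the square lies on one of
  the two sides. In \<open>B\<close> it yields a crossing edge of \<open>R\<close> at the left end,
  in \<open>A\<close> one at the right end; the second kind is reduced to the first by swapping the
  sides.\<close>

lemma cut_le_square:
  assumes "symp R" "A \<inter> B = {}" "cut_le R A B k"
    and closed: "\<And>a w. a \<in> A \<Longrightarrow> R a w \<Longrightarrow> w \<in> A \<union> B"
  shows "cut_le (square R) A B (2 * k)"
proof (rule cut_leI)
  fix M assume M: "cross_matching (square R) A B M"
  let ?P = "\<lambda>a b. \<exists>w\<in>B. R a w \<and> (w = b \<or> R w b)"
  let ?M1 = "{(a, b). (a, b) \<in> M \<and> ?P a b}"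
  let ?M2 = "{(a, b). (a, b) \<in> M \<and> \<not> ?P a b}"
  have "cross_matching (square R) A B ?M1" using M by (rule cross_matching_subset) auto
  then have 1: "card ?M1 \<le> k" using assms(2,3) by (rule card_le_half_cross_matching_square) auto
  have sub2: "cross_matching (square R) A B ?M2" using M by (rule cross_matching_subset) auto
  have "card (prod.swap ` ?M2) \<le> k"
  proof (rule card_le_half_cross_matching_square)
    show "cross_matching (square R) B A (prod.swap ` ?M2)"
      using symp_square[OF assms(1)] sub2 by (rule cross_matching_swap)
    show "B \<inter> A = {}" "cut_le R B A k" using assms(1-3) cut_le_swap by auto
    fix b a assume "(b, a) \<in> prod.swap ` ?M2"
    then have "(a, b) \<in> M" "\<not> ?P a b" by auto
    note ab = cross_matchingD[OF M \<open>(a, b) \<in> M\<close>]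
    have "\<not> R a b" using \<open>\<not> ?P a b\<close> ab(2) by blast
    then obtain w where w: "R a w" "R w b" using ab(3) by (auto simp: square_def)
    then have "w \<in> A" using closed[OF ab(1) w(1)] \<open>\<not> ?P a b\<close> by blast
    then show "\<exists>w\<in>A. R b w \<and> (w = a \<or> R w a)"
      using sympD[OF assms(1) w(1)] sympD[OF assms(1) w(2)] by blast
  qed
  then have 2: "card ?M2 \<le> k" by (simp add: card_image)
  have "card M = card (?M1 \<union> ?M2)" by (rule arg_cong[of _ _ card]) auto
  also have "\<dots> \<le> card ?M1 + card ?M2" by (rule card_Un_le)
  finally show "card M \<le> 2 * k" using 1 2 by linarith
qed

lemma lmw_le_square:
  assumes "symp R" "lmw_le R V k" "\<And>a w. a \<in> V \<Longrightarrow> R a w \<Longrightarrow> w \<in> V"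
  shows "lmw_le (square R) V (2 * k)"
proof -
  obtain xs where xs: "distinct xs" "set xs = V" "layout_le R xs k"
    using assms(2) by (auto simp: lmw_le_def)
  have "layout_le (square R) xs (2 * k)"
  proof (rule layout_leI)
    fix ys zs assume split: "xs = ys @ zs"
    then have "cut_le R (set ys) (set zs) k" using xs by (simp add: layout_le_def)
    then show "cut_le (square R) (set ys) (set zs) (2 * k)"
      using assms(3) xs split by (intro cut_le_square assms(1)) auto
  qed
  then show ?thesis using xs by (auto simp: lmw_le_def)
qed

section \<open>A lower bound from three branches\<close>

definition conn :: "('a \<Rightarrow> 'a \<Rightarrow> bool) \<Rightarrow> 'a set \<Rightarrow> bool" where
  "conn R D \<longleftrightarrow> (\<forall>a\<in>D. \<forall>b\<in>D. (\<lambda>x y. R x y \<and> x \<in> D \<and> y \<in> D)\<^sup>*\<^sup>* a b)"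

lemma rtranclp_weaken: "P\<^sup>*\<^sup>* a b \<Longrightarrow> (\<And>x y. P x y \<Longrightarrow> Q x y) \<Longrightarrow> Q\<^sup>*\<^sup>* a b"
  by (erule rtranclp_mono[THEN predicate2D, rotated]) blast

lemma conn_mono: "conn R D \<Longrightarrow> (\<And>x y. R x y \<Longrightarrow> x \<in> D \<Longrightarrow> y \<in> D \<Longrightarrow> R' x y) \<Longrightarrow> conn R' D"
  unfolding conn_def by (blast intro: rtranclp_weaken)

lemma conn_Un:
  assumes "conn R D" "conn R D'" "a \<in> D" "b \<in> D'" "R a b" "R b a"
  shows "conn R (D \<union> D')"
proof -
  let ?r = "(\<lambda>x y. R x y \<and> x \<in> D \<union> D' \<and> y \<in> D \<union> D')\<^sup>*\<^sup>*"
  have D: "?r x y" if "x \<in> D" "y \<in> D" for x y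
    using assms(1) that unfolding conn_def by (blast intro: rtranclp_weaken)
  have D': "?r x y" if "x \<in> D'" "y \<in> D'" for x y
    using assms(2) that unfolding conn_def by (blast intro: rtranclp_weaken)
  have ab: "?r a b" "?r b a" using assms(3-6) by (blast intro: r_into_rtranclp)+
  show ?thesis unfolding conn_def
  proof (intro ballI)
    fix x y assume xy: "x \<in> D \<union> D'" "y \<in> D \<union> D'"
    have "?r x a" using xy(1) D[OF _ assms(3)] rtranclp_trans[OF D'[OF _ assms(4)] ab(2)] by blast
    also have "?r a y" using xy(2) D[OF assms(3)] rtranclp_trans[OF ab(1) D'[OF assms(4)]] by blast
    finally show "?r x y" .
  qed
qed

lemma conn_single [simp]: "conn R {x}"
  by (simp add: conn_def)

lemma conn_crossing:
  assumes "conn R D" "a \<in> D" "a \<in> P" "b \<in> D" "b \<notin> P"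
  obtains c d where "c \<in> D" "c \<in> P" "d \<in> D" "d \<notin> P" "R c d"
proof -
  have "(\<lambda>x y. R x y \<and> x \<in> D \<and> y \<in> D)\<^sup>*\<^sup>* a b" using assms by (simp add: conn_def)
  then have "\<exists>c d. c \<in> D \<and> c \<in> P \<and> d \<in> D \<and> d \<notin> P \<and> R c d"
    using assms(5)
  proof (induction rule: rtranclp_induct)
    case base
    then show ?case using assms(3) by simp
  next
    case (step y z)
    then show ?case by blast
  qed
  then show ?thesis using that by blast
qed

text \<open>At the median of the three cuts realising the widths of the sets \<open>C i\<close>, the
  connected set around the other two crosses the cut and contributes one more edge.\<close>

lemma not_lmw_le_Suc:
  fixes C :: "nat \<Rightarrow> 'a set"
  assumes "symp R"
    and wide: "\<And>i. i < 3 \<Longrightarrow> \<not> lmw_le R (C i) k"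
    and sub: "\<And>i. i < 3 \<Longrightarrow> C i \<subseteq> V"
    and link: "\<And>i j l. \<lbrakk>i < 3; j < 3; l < 3; i \<noteq> j; i \<noteq> l; j \<noteq> l\<rbrakk> \<Longrightarrow>
      \<exists>D. C j \<subseteq> D \<and> C l \<subseteq> D \<and> D \<subseteq> V \<and> conn R D \<and> (\<forall>a\<in>D. \<forall>b\<in>C i. a \<noteq> b \<and> \<not> R a b)"
  shows "\<not> lmw_le R V (Suc k)"
proof
  assume "lmw_le R V (Suc k)"
  then obtain xs where xs: "distinct xs" "set xs = V" "layout_le R xs (Suc k)"
    by (auto simp: lmw_le_def)
  let ?L = "\<lambda>p. set (take p xs)" and ?U = "\<lambda>p. set (drop p xs)"
  \<comment> \<open>The order that \<open>xs\<close> induces on \<open>C i\<close> has a bad cut;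
    \<open>p\<close> is a position of that cut in the whole list, so that the three cuts become
    comparable.\<close>
  have "\<exists>p M. cross_matching R (?L p \<inter> C i) (?U p \<inter> C i) M \<and> k < card M" if i: "i < 3" for i
  proof -
    let ?ys = "filter (\<lambda>v. v \<in> C i) xs"
    have "distinct ?ys" "set ?ys = C i" using xs sub[OF i] by auto
    then have "\<not> layout_le R ?ys k" using wide[OF i] unfolding lmw_le_def by blast
    then obtain as bs M where split: "?ys = as @ bs" and M: "cross_matching R (set as) (set bs) M" "k < card M"
      unfolding layout_le_def cut_le_def by (auto simp: not_le)
    obtain us vs where "xs = us @ vs" "as = filter (\<lambda>v. v \<in> C i) us" "bs = filter (\<lambda>v. v \<in> C i) vs"
      using filter_eq_appendD[OF split] by blast
    then have "set as = ?L (length us) \<inter> C i" "set bs = ?U (length us) \<inter> C i" by auto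
    then show ?thesis using M by metis
  qed
  then obtain p M where M: "cross_matching R (?L (p i) \<inter> C i) (?U (p i) \<inter> C i) (M i)"
    and kM: "k < card (M i)" if "i < 3" for i by metis
  have left: "\<exists>a. a \<in> C i \<and> a \<in> ?L (p i)" and right: "\<exists>a. a \<in> C i \<and> a \<in> ?U (p i)" if "i < 3" for i
  proof -
    have "M i \<noteq> {}" using kM[OF that] by auto
    then show "\<exists>a. a \<in> C i \<and> a \<in> ?L (p i)" "\<exists>a. a \<in> C i \<and> a \<in> ?U (p i)"
      using cross_matching_subset_times[OF M[OF that]] by auto
  qed
  \<comment> \<open>Name the three indices so that \<open>p i\<close> is the median.\<close>
  have "\<exists>i j l. i < 3 \<and> j < 3 \<and> l < 3 \<and> i \<noteq> j \<and> i \<noteq> l \<and> j \<noteq> l \<and> p j \<le> p i \<and> p i \<le> p l"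
  proof -
    have *: "\<exists>i j l. i < 3 \<and> j < 3 \<and> l < 3 \<and> i \<noteq> j \<and> i \<noteq> l \<and> j \<noteq> l \<and> p j \<le> p i \<and> p i \<le> p l"
      if "p j \<le> p i" "p i \<le> p l" "j < 3" "i < 3" "l < 3" "i \<noteq> j" "i \<noteq> l" "j \<noteq> l" for j i l :: nat
      using that by blast
    consider "p 0 \<le> p 1" "p 1 \<le> p 2"
      | "p 0 \<le> p 2" "p 2 \<le> p 1"
      | "p 1 \<le> p 0" "p 0 \<le> p 2"
      | "p 1 \<le> p 2" "p 2 \<le> p 0"
      | "p 2 \<le> p 0" "p 0 \<le> p 1"
      | "p 2 \<le> p 1" "p 1 \<le> p 0"
      by linarith
    then show ?thesis
    proof cases
      case 1
      then show ?thesis by (rule *[of 0 1 2]) simp_all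
    next
      case 2
      then show ?thesis by (rule *[of 0 2 1]) simp_all
    next
      case 3
      then show ?thesis by (rule *[of 1 0 2]) simp_all
    next
      case 4
      then show ?thesis by (rule *[of 1 2 0]) simp_all
    next
      case 5
      then show ?thesis by (rule *[of 2 0 1]) simp_all
    next
      case 6
      then show ?thesis by (rule *[of 2 1 0]) simp_all
    qed
  qed
  then obtain i j l where ijl: "i < 3" "j < 3" "l < 3" "i \<noteq> j" "i \<noteq> l" "j \<noteq> l" "p j \<le> p i" "p i \<le> p l"
    by blast
  obtain D where D: "C j \<subseteq> D" "C l \<subseteq> D" "D \<subseteq> V" "conn R D" "\<forall>a\<in>D. \<forall>b\<in>C i. a \<noteq> b \<and> \<not> R a b"
    using link[OF ijl(1-6)] by blast
  \<comment> \<open>The matching \<open>M j\<close> has a left end before \<open>p j\<close>, hence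
    before \<open>p i\<close>, and \<open>M l\<close> has a right end after \<open>p l\<close>,
    hence after \<open>p i\<close>. So \<open>D\<close> has vertices on both sides of the median
    cut.\<close>
  obtain a where "a \<in> C j" "a \<in> ?L (p j)" using left[OF ijl(2)] by (elim exE conjE)
  then have a: "a \<in> D" "a \<in> ?L (p i)"
    using D(1) set_take_subset_set_take[OF ijl(7)] by (metis subsetD)+
  obtain b where "b \<in> C l" "b \<in> ?U (p l)" using right[OF ijl(3)] by (elim exE conjE)
  then have b: "b \<in> D" "b \<in> ?U (p i)"
    using D(2) set_drop_subset_set_drop[OF ijl(8)] by (metis subsetD)+
  have "?L (p i) \<inter> ?U (p i) = {}" using xs(1) by (simp add: set_take_disj_set_drop_if_distinct)
  then have "b \<notin> ?L (p i)" using b(2) by blast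
  then obtain c d where cd: "c \<in> D" "c \<in> ?L (p i)" "d \<in> D" "d \<notin> ?L (p i)" "R c d"
    using conn_crossing[OF D(4) a b(1)] by blast
  have "d \<in> set xs" using cd(3) D(3) xs(2) by blast
  then have d: "d \<in> ?U (p i)" using cd(4) by (metis Un_iff append_take_drop_id set_append)
  have "cross_matching R (?L (p i)) (?U (p i)) (insert (c, d) (M i))"
    unfolding cross_matching_def
  proof (intro conjI allI impI)
    fix x y assume "(x, y) \<in> insert (c, d) (M i)"
    then show "x \<in> ?L (p i)" "y \<in> ?U (p i)" "R x y"
      using cross_matchingD[OF M[OF ijl(1)], of x y] cd d by auto
  next
    fix x y z w assume *: "(x, y) \<in> insert (c, d) (M i)" "(z, w) \<in> insert (c, d) (M i)" "(x, y) \<noteq> (z, w)"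
    have in_C: "x \<in> C i" "y \<in> C i" if "(x, y) \<in> M i" for x y
      using cross_matchingD[OF M[OF ijl(1)] that] by auto
    consider "(x, y) \<in> M i" "(z, w) \<in> M i" | "(x, y) = (c, d)" "(z, w) \<in> M i"
      | "(x, y) \<in> M i" "(z, w) = (c, d)" using * by blast
    then show "\<not> R x w"
    proof cases
      case 1
      then show ?thesis using cross_matching_eq[OF M[OF ijl(1)]] *(3) by blast
    next
      case 2
      then show ?thesis using D(5) cd(1) in_C[OF 2(2)] by blast
    next
      case 3
      then show ?thesis using D(5) cd(3) in_C[OF 3(1)] sympD[OF assms(1)] by blast
    qed
  qed
  moreover have "cut_le R (?L (p i)) (?U (p i)) (Suc k)"
    using xs(3) by (metis append_take_drop_id layout_le_def)
  ultimately have "card (insert (c, d) (M i)) \<le> Suc k" by (rule cut_leD[rotated])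
  moreover have "(c, d) \<notin> M i" using cross_matchingD[OF M[OF ijl(1)], of c d] D(5) cd(1) by blast
  \<comment> \<open>An infinite set has \<open>card\<close> equal to 0, which
    \<open>k < card (M i)\<close> rules out.\<close>
  moreover have "finite (M i)" using kM[OF ijl(1)] by (metis card.infinite not_less0)
  ultimately show False using kM[OF ijl(1)] by simp
qed

lemma not_lmw_le_0:
  assumes "a \<in> V" "b \<in> V" "a \<noteq> b" "R a b" "R b a"
  shows "\<not> lmw_le R V 0"
proof
  assume "lmw_le R V 0"
  then have "lmw_le R {a, b} 0" using assms by (elim lmw_le_subset) auto
  then obtain xs where xs: "distinct xs" "set xs = {a, b}" "layout_le R xs 0"
    by (auto simp: lmw_le_def)
  then obtain x y where "xs = [x] @ [y]" "R x y"
  proof -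
    have "length xs = 2" using xs(1,2) assms(3) distinct_card by fastforce
    then obtain x y where "xs = [x, y]" by (auto simp: numeral_2_eq_2 length_Suc_conv)
    then show thesis using that xs assms by (auto simp: doubleton_eq_iff)
  qed
  then have "cut_le R (set [x]) (set [y]) 0" using xs(3) unfolding layout_le_def by blast
  then have "cut_le R {x} {y} 0" by simp
  moreover have "cross_matching R {x} {y} {(x, y)}" using \<open>R x y\<close> by (auto simp: cross_matching_def)
  ultimately show False using cut_leD by fastforce
qed

section \<open>Layouts extended to the right of an already placed set\<close>

definition layout_after_le :: "('a \<Rightarrow> 'a \<Rightarrow> bool) \<Rightarrow> 'a set \<Rightarrow> 'a list \<Rightarrow> nat \<Rightarrow> bool" where
  "layout_after_le R A xs k \<longleftrightarrow> (\<forall>ys zs. xs = ys @ zs \<longrightarrow> cut_le R (A \<union> set ys) (set zs) k)"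

lemma layout_after_le_Nil [simp]: "layout_after_le R A [] k"
  by (auto simp: layout_after_le_def)

lemma layout_le_Cons: "layout_le R (x # xs) k \<longleftrightarrow> layout_after_le R {x} xs k"
proof
  assume *: "layout_le R (x # xs) k"
  show "layout_after_le R {x} xs k"
    unfolding layout_after_le_def
  proof (intro allI impI)
    fix ys zs assume "xs = ys @ zs"
    then have "x # xs = (x # ys) @ zs" by simp
    then have "cut_le R (set (x # ys)) (set zs) k" using * unfolding layout_le_def by blast
    then show "cut_le R ({x} \<union> set ys) (set zs) k" by simp
  qed
next
  assume "layout_after_le R {x} xs k"
  then show "layout_le R (x # xs) k"
    by (auto simp: layout_le_def layout_after_le_def Cons_eq_append_conv)
qed

text \<open>After the vertices of \<open>A\<close>, a block \<open>L\<close> is laid out in its own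
  order, followed by the vertex \<open>v\<close> that attaches it to the rest. A cut before
  \<open>v\<close> meets \<open>L\<close> in one of its own cuts, and by \<open>conf\<close> the
  other crossing edges contribute at most one matching edge. A cut after \<open>v\<close> is a cut
  of \<open>rest\<close>.\<close>

lemma layout_after_le_block:
  assumes "layout_le R L k" and rest: "layout_after_le R (A \<union> set L \<union> {v}) rest (Suc k)"
    and "A \<inter> set L = {}" "v \<notin> set L" "set rest \<inter> set L = {}"
    and conf: "\<And>a b c d. \<lbrakk>a \<in> A \<union> set L; b \<in> set L \<union> {v} \<union> set rest; R a b; \<not> (a \<in> set L \<and> b \<in> set L);
       c \<in> A \<union> set L; d \<in> set L \<union> {v} \<union> set rest; R c d; \<not> (c \<in> set L \<and> d \<in> set L)\<rbrakk> \<Longrightarrow> R a d \<or> R c b"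
  shows "layout_after_le R A (L @ v # rest) (Suc k)"
  unfolding layout_after_le_def
proof (intro allI impI)
  fix ys zs assume "L @ v # rest = ys @ zs"
  then consider us where "L = ys @ us" "zs = us @ v # rest" | us where "ys = L @ v # us" "rest = us @ zs"
    by (fastforce simp: append_eq_append_conv2 Cons_eq_append_conv)
  then show "cut_le R (A \<union> set ys) (set zs) (Suc k)"
  proof cases
    case 1
    show ?thesis
    proof (rule cut_le_Suc)
      have "cut_le R (set ys) (set us) k" using assms(1) 1 by (simp add: layout_le_def)
      moreover have "(A \<union> set ys) \<inter> set L = set ys" "set zs \<inter> set L = set us"
        using 1 assms(3-5) by auto
      ultimately show "cut_le R ((A \<union> set ys) \<inter> set L) (set zs \<inter> set L) k" by simp
    next
      fix a b c d
      assume *: "a \<in> A \<union> set ys" "b \<in> set zs" "R a b" "\<not> (a \<in> set L \<and> b \<in> set L)"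
        "c \<in> A \<union> set ys" "d \<in> set zs" "R c d" "\<not> (c \<in> set L \<and> d \<in> set L)"
      have "A \<union> set ys \<subseteq> A \<union> set L" "set zs \<subseteq> set L \<union> {v} \<union> set rest" using 1 by auto
      then show "R a d \<or> R c b" using * by (intro conf) blast+
    qed
  next
    case 2
    then have "cut_le R (A \<union> set L \<union> {v} \<union> set us) (set zs) (Suc k)"
      using rest by (simp add: layout_after_le_def)
    moreover have "A \<union> set L \<union> {v} \<union> set us = A \<union> set ys" using 2 by auto
    ultimately show ?thesis by simp
  qed
qed

section \<open>Trees\<close>

text \<open>For a neighbour \<open>v\<close> of \<open>x\<close> in \<open>C\<close>, this is the
  component of \<open>C - {x}\<close> that contains \<open>v\<close>.\<close>

definition branch :: "('a \<Rightarrow> 'a \<Rightarrow> bool) \<Rightarrow> 'a set \<Rightarrow> 'a \<Rightarrow> 'a \<Rightarrow> 'a set" where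
  "branch R C x v = {y. (\<lambda>a b. R a b \<and> a \<in> C - {x} \<and> b \<in> C - {x})\<^sup>*\<^sup>* v y}"

text \<open>Acyclicity says that deleting \<open>x\<close> separates its distinct neighbours. It
  speaks of reachability rather than of cycles, and of no vertex set, so that one infinite forest
  can serve all its finite subtrees.\<close>

locale forest =
  fixes R :: "'a \<Rightarrow> 'a \<Rightarrow> bool"
  assumes symp: "symp R" and irrefl: "\<not> R x x"
    and acyclic: "\<lbrakk>R x v; R x w; (\<lambda>a b. R a b \<and> a \<noteq> x \<and> b \<noteq> x)\<^sup>*\<^sup>* v w\<rbrakk> \<Longrightarrow> v = w"
begin

lemma sym: "R a b \<Longrightarrow> R b a"
  using symp by (rule sympD)

text \<open>In \<open>square R\<close> the midpoint ranges over the whole type, so restricting it to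
  \<open>D\<close> might give more than the square of the subgraph on \<open>D\<close>. For
  connected \<open>D\<close> it does not: a midpoint outside \<open>D\<close> would have two
  distinct neighbours joined by a path that avoids it.\<close>

lemma square_in_conn:
  assumes "conn R D" "a \<in> D" "b \<in> D" "square R a b"
  shows "R a b \<or> (\<exists>w\<in>D. R a w \<and> R w b)"
proof (rule ccontr)
  assume no: "\<not> ?thesis"
  then obtain w where w: "R a w" "R w b" "w \<notin> D" using assms(4) by (auto simp: square_def)
  have "(\<lambda>x y. R x y \<and> x \<in> D \<and> y \<in> D)\<^sup>*\<^sup>* a b" using assms(1-3) by (simp add: conn_def)
  then have "(\<lambda>x y. R x y \<and> x \<noteq> w \<and> y \<noteq> w)\<^sup>*\<^sup>* a b"
    by (rule rtranclp_weaken) (use w(3) in blast)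
  then have "a = b" using acyclic sym w by blast
  then show False using assms(4) by (simp add: square_def)
qed

end

locale subtree = forest +
  fixes C :: "'a set"
  assumes conn: "conn R C" and fin: "finite C"
begin

abbreviation "B \<equiv> branch R C"

definition nbrs :: "'a \<Rightarrow> 'a set" where
  "nbrs x = {v \<in> C. R x v}"

lemma nbrsD: "v \<in> nbrs x \<Longrightarrow> v \<in> C \<and> R x v \<and> R v x \<and> v \<noteq> x"
  using irrefl sym by (auto simp: nbrs_def)

lemma nbrs_sym: "x \<in> C \<Longrightarrow> v \<in> nbrs x \<Longrightarrow> x \<in> nbrs v"
  using sym by (auto simp: nbrs_def)

lemma finite_nbrs: "finite (nbrs x)"
  using fin by (simp add: nbrs_def)

lemma root_in_branch [simp]: "v \<in> B x v"
  by (simp add: branch_def)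

lemma branch_step: "y \<in> B x v \<Longrightarrow> R y z \<Longrightarrow> y \<in> C - {x} \<Longrightarrow> z \<in> C - {x} \<Longrightarrow> z \<in> B x v"
  unfolding branch_def by (simp add: rtranclp.rtrancl_into_rtrancl)

lemma branch_subset:
  assumes "v \<in> nbrs x"
  shows "B x v \<subseteq> C - {x}"
proof
  fix y assume "y \<in> B x v"
  then have "(\<lambda>a b. R a b \<and> a \<in> C - {x} \<and> b \<in> C - {x})\<^sup>*\<^sup>* v y" by (simp add: branch_def)
  then show "y \<in> C - {x}" using nbrsD[OF assms] by (induction rule: rtranclp_induct) auto
qed

lemma branch_induct [consumes 2, case_names root step]:
  assumes "y \<in> B x v" "v \<in> nbrs x" "P v"
    and "\<And>y z. \<lbrakk>y \<in> B x v; z \<in> B x v; R y z; P y\<rbrakk> \<Longrightarrow> P z"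
  shows "P y"
proof -
  have "(\<lambda>a b. R a b \<and> a \<in> C - {x} \<and> b \<in> C - {x})\<^sup>*\<^sup>* v y" using assms(1) by (simp add: branch_def)
  then have "y \<in> B x v \<and> P y"
  proof (induction rule: rtranclp_induct)
    case base
    then show ?case using assms(3) by simp
  next
    case (step y z)
    then show ?case using assms(4)[of y z] branch_step[of y x v z] by blast
  qed
  then show ?thesis ..
qed

lemma conn_branch:
  assumes "v \<in> nbrs x"
  shows "conn R (B x v)"
proof -
  let ?r = "\<lambda>a b. R a b \<and> a \<in> B x v \<and> b \<in> B x v"
  have 1: "?r\<^sup>*\<^sup>* v y" if "y \<in> B x v" for y
    using that assms
  proof (induction rule: branch_induct)
    case (step y z)
    then show ?case by (simp add: rtranclp.rtrancl_into_rtrancl)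
  qed simp
  have 2: "?r\<^sup>*\<^sup>* y v" if "y \<in> B x v" for y
    using that assms
  proof (induction rule: branch_induct)
    case (step y z)
    then have "?r z y" using sym by blast
    then show ?case using step(4) by (rule converse_rtranclp_into_rtranclp)
  qed simp
  show ?thesis unfolding conn_def using 1 2 by (meson rtranclp_trans)
qed

lemma branch_eqI:
  assumes "v \<in> nbrs x" "w \<in> nbrs x" "y \<in> B x v" "y \<in> B x w"
  shows "v = w"
proof -
  let ?r = "\<lambda>a b. R a b \<and> a \<noteq> x \<and> b \<noteq> x"
  have to: "?r\<^sup>*\<^sup>* v y \<and> ?r\<^sup>*\<^sup>* y v" if "v \<in> nbrs x" "y \<in> B x v" for v
  proof -
    have "(\<lambda>a b. R a b \<and> a \<in> B x v \<and> b \<in> B x v)\<^sup>*\<^sup>* v y"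
      "(\<lambda>a b. R a b \<and> a \<in> B x v \<and> b \<in> B x v)\<^sup>*\<^sup>* y v"
      using conn_branch[OF that(1)] that(2) by (simp_all add: conn_def)
    then show ?thesis
      using branch_subset[OF that(1)] by (auto elim!: rtranclp_weaken)
  qed
  have "?r\<^sup>*\<^sup>* v w" using to[OF assms(1,3)] to[OF assms(2,4)] by (meson rtranclp_trans)
  then show ?thesis using acyclic nbrsD assms(1,2) by blast
qed

text \<open>A vertex of the branch that is adjacent to \<open>x\<close> is itself a neighbour of
  \<open>x\<close> whose own branch meets this one, so by \<open>branch_eqI\<close> it is
  \<open>v\<close>. The edge from \<open>v\<close> to \<open>x\<close> is thus the only way
  out.\<close>

lemma branch_exit:
  assumes "v \<in> nbrs x" "y \<in> B x v" "R y z" "z \<in> C"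
  shows "z \<in> B x v \<or> y = v \<and> z = x"
proof (cases "z = x")
  case True
  then have "y \<in> nbrs x" using assms branch_subset sym by (auto simp: nbrs_def)
  then have "y = v" using branch_eqI[OF _ assms(1) root_in_branch assms(2)] by blast
  then show ?thesis using True by simp
next
  case False
  then show ?thesis using branch_step assms branch_subset by blast
qed

lemma branch_cover:
  assumes "x \<in> C" "y \<in> C" "y \<noteq> x"
  shows "\<exists>v\<in>nbrs x. y \<in> B x v"
proof -
  have "(\<lambda>a b. R a b \<and> a \<in> C \<and> b \<in> C)\<^sup>*\<^sup>* x y" using conn assms by (simp add: conn_def)
  then have "y = x \<or> (\<exists>v\<in>nbrs x. y \<in> B x v)"
  proof (induction rule: rtranclp_induct)
    case base
    then show ?case by simp
  next
    case (step y z)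
    show ?case
    proof (cases "z = x \<or> y = x")
      case True
      then show ?thesis using step(2) root_in_branch by (auto simp: nbrs_def)
    next
      case False
      then show ?thesis using step branch_step by blast
    qed
  qed
  then show ?thesis using assms(3) by blast
qed

text \<open>Walking from \<open>x\<close> without using \<open>v\<close>, one stays at
  \<open>x\<close> or in a branch at \<open>x\<close> other than that of \<open>v\<close>; distinct
  branches at \<open>x\<close> do not meet.\<close>

lemma branch_opposite_disjoint:
  assumes "x \<in> C" "v \<in> nbrs x"
  shows "B x v \<inter> B v x = {}"
proof -
  have "y = x \<or> (\<exists>w\<in>nbrs x - {v}. y \<in> B x w)" if "y \<in> B v x" for y
    using that nbrs_sym[OF assms]
  proof (induction rule: branch_induct)
    case root
    then show ?case by simp
  next
    case (step y z)
    have yz: "y \<in> C - {v}" "z \<in> C - {v}" using step(1,2) branch_subset nbrs_sym[OF assms] by blast+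
    show ?case
    proof (cases "z = x \<or> y = x")
      case True
      then have "z = x \<or> z \<in> nbrs x - {v} \<and> z \<in> B x z"
        using step(3) yz by (auto simp: nbrs_def)
      then show ?thesis by blast
    next
      case False
      then show ?thesis using step yz branch_step by blast
    qed
  qed
  then show ?thesis using branch_eqI assms(2) branch_subset[OF assms(2)] by blast
qed

text \<open>The recursive structure of a branch, seen from its root: \<open>v\<close> and the
  branches at \<open>v\<close> that lead away from \<open>x\<close>. The layouts below are built
  along it.\<close>

lemma branch_unfold:
  assumes "x \<in> C" "v \<in> nbrs x"
  shows "B x v = insert v (\<Union>u\<in>nbrs v - {x}. B v u)"
proof (intro equalityI subsetI)
  fix y assume y: "y \<in> B x v"
  show "y \<in> insert v (\<Union>u\<in>nbrs v - {x}. B v u)"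
  proof (cases "y = v")
    case False
    then obtain u where "u \<in> nbrs v" "y \<in> B v u"
      using branch_cover y assms branch_subset nbrsD by blast
    moreover have "u \<noteq> x" using branch_opposite_disjoint[OF assms] y \<open>y \<in> B v u\<close> by blast
    ultimately show ?thesis by blast
  qed simp
next
  fix y assume "y \<in> insert v (\<Union>u\<in>nbrs v - {x}. B v u)"
  moreover have "y \<in> B x v" if u: "u \<in> nbrs v" "u \<noteq> x" and "y \<in> B v u" for u
    using that(3,1)
  proof (induction rule: branch_induct)
    case root
    then show ?case using branch_step[of v x v u] nbrsD[OF u(1)] nbrsD[OF assms(2)] u(2) by simp
  next
    case (step y z)
    have "x \<notin> B v u" using branch_eqI[of x v u x] nbrs_sym[OF assms] u by auto
    then show ?case using branch_step[of y x v z] step branch_subset[OF u(1)] by blast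
  qed
  ultimately show "y \<in> B x v" by auto
qed

lemma branch_psubset:
  assumes "x \<in> C" "v \<in> nbrs x" "u \<in> nbrs v" "u \<noteq> x"
  shows "B v u \<subset> B x v"
  using branch_unfold[OF assms(1,2)] branch_subset[OF assms(3)] assms by blast

lemma branch_Un_opposite:
  assumes "x \<in> C" "v \<in> nbrs x"
  shows "B x v \<union> B v x = C"
proof (intro equalityI subsetI)
  fix y assume y: "y \<in> C"
  show "y \<in> B x v \<union> B v x"
  proof (cases "y = x")
    case False
    then obtain w where "w \<in> nbrs x" "y \<in> B x w" using branch_cover assms(1) y by blast
    then show ?thesis using branch_unfold[of v x] nbrs_sym[OF assms] nbrsD[OF assms(2)] by blast
  qed simp
qed (use branch_subset nbrs_sym assms in blast)

section \<open>Layouts of branches that begin at the root\<close>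

definition rooted_le :: "nat \<Rightarrow> 'a set \<Rightarrow> 'a \<Rightarrow> bool" where
  "rooted_le k W x \<longleftrightarrow> (\<exists>xs. distinct (x # xs) \<and> set (x # xs) = W \<and> layout_le R (x # xs) k)"

lemma rooted_le_single: "rooted_le k {x} x"
  unfolding rooted_le_def by (rule exI[of _ "[]"]) simp

text \<open>Having the root at an end makes layouts extendable there: the edge from \<open>x\<close>
  to \<open>z\<close> is the only one from \<open>x\<close> into the branch, so it crosses just the
  cut between \<open>x\<close> and \<open>z\<close>.\<close>

lemma rooted_le_Cons:
  assumes "x \<in> C" "z \<in> nbrs x" "rooted_le (Suc k) (B x z) z"
  shows "rooted_le (Suc k) (insert x (B x z)) x"
proof -
  obtain zs where zs: "distinct (z # zs)" "set (z # zs) = B x z" "layout_le R (z # zs) (Suc k)"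
    using assms(3) unfolding rooted_le_def by blast
  have "layout_le R ([x] @ (z # zs)) (Suc k)"
  proof (rule layout_le_append)
    have "cut_le R (set [x] \<inter> {}) (set (z # zs) \<inter> {}) k" by simp
    then show "cut_le R (set [x]) (set (z # zs)) (Suc k)" by (rule cut_le_Suc[of _ _ "{}"]) auto
    fix a b assume "a \<in> set [x]" "b \<in> set (tl (z # zs))"
    then have b: "a = x" "b \<in> B x z" "b \<noteq> z" using zs by auto
    then show "\<not> R a b" using branch_exit[OF assms(2), of b x] assms(1) branch_subset[OF assms(2)] sym by blast
  qed (use zs in simp_all)
  then show ?thesis
    using zs branch_subset[OF assms(2)] unfolding rooted_le_def by (intro exI[of _ "z # zs"]) auto
qed

text \<open>The light branch is inserted directly behind the root, in the order \<open>x\<close>,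
  \<open>L\<close>, \<open>v\<close>, \<open>ws\<close>. Before \<open>v\<close>, every crossing
  edge outside \<open>L\<close> starts at \<open>x\<close> or ends at \<open>v\<close>; as
  \<open>x\<close> and \<open>v\<close> are adjacent, any two of these edges conflict.\<close>

lemma rooted_le_Un_branch:
  assumes W: "rooted_le (Suc k) W x" "W \<subseteq> C" and "W \<inter> B x v = {}" "x \<in> C" "v \<in> nbrs x"
    and light: "lmw_le R (B x v - {v}) k"
  shows "rooted_le (Suc k) (W \<union> B x v) x"
proof -
  obtain ws where ws: "distinct (x # ws)" "set (x # ws) = W" "layout_le R (x # ws) (Suc k)"
    using W(1) unfolding rooted_le_def by blast
  obtain L where L: "distinct L" "set L = B x v - {v}" "layout_le R L k"
    using light unfolding lmw_le_def by blast
  have no: "\<not> R a b" if "a \<in> B x v" "b \<in> set ws" for a b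
    using branch_exit[OF assms(5) that(1), of b] that(2) ws(1,2) assms(2,3) by auto
  have Lx: "b = v" if "a \<in> set L" "b \<in> set L \<union> {v} \<union> set ws" "R a b" "b \<notin> set L" for a b
    using that no L(2) by auto
  have "x \<notin> B x v" using branch_subset[OF assms(5)] by blast
  have "layout_after_le R {x} (L @ v # ws) (Suc k)"
  proof (rule layout_after_le_block[OF L(3)])
    show "{x} \<inter> set L = {}" "v \<notin> set L" "set ws \<inter> set L = {}"
      using L(2) ws(2) assms(3) \<open>x \<notin> B x v\<close> by auto
    \<comment> \<open>Past \<open>v\<close>, nothing in the inserted branch is adjacent to
      \<open>ws\<close>, so the crossing edges are those of the old layout.\<close>
    show "layout_after_le R ({x} \<union> set L \<union> {v}) ws (Suc k)"
      unfolding layout_after_le_def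
    proof (intro allI impI)
      fix ys zs assume split: "ws = ys @ zs"
      then have "cut_le R ({x} \<union> set ys) (set zs) (Suc k)"
        using ws(3) unfolding layout_le_Cons layout_after_le_def by blast
      then show "cut_le R ({x} \<union> set L \<union> {v} \<union> set ys) (set zs) (Suc k)"
        by (rule cut_le_subset) (use no L(2) split in auto)
    qed
    fix a b c d
    assume *: "a \<in> {x} \<union> set L" "b \<in> set L \<union> {v} \<union> set ws" "R a b" "\<not> (a \<in> set L \<and> b \<in> set L)"
      "c \<in> {x} \<union> set L" "d \<in> set L \<union> {v} \<union> set ws" "R c d" "\<not> (c \<in> set L \<and> d \<in> set L)"
    have "a = x \<or> b = v" using Lx[OF _ *(2,3)] *(1,4) by blast
    moreover have "c = x \<or> d = v" using Lx[OF _ *(6,7)] *(5,8) by blast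
    moreover have "R x v" using nbrsD[OF assms(5)] by blast
    ultimately show "R a d \<or> R c b" using *(3,7) by metis
  qed
  then have "layout_le R (x # L @ v # ws) (Suc k)" unfolding layout_le_Cons .
  moreover have "distinct (x # L @ v # ws)"
  proof -
    have "set ws \<inter> B x v = {}" using ws(2) assms(3) by auto
    then have "x \<notin> set L" "x \<noteq> v" "v \<notin> set L" "set L \<inter> set ws = {}" "v \<notin> set ws"
      using L(2) \<open>x \<notin> B x v\<close> root_in_branch by blast+
    then show ?thesis using ws(1) L(1) by simp
  qed
  moreover have "set (x # L @ v # ws) = W \<union> B x v"
  proof -
    have "set (x # L @ v # ws) = set (x # ws) \<union> insert v (set L)" by auto
    also have "insert v (set L) = B x v" unfolding L(2) using root_in_branch by blast
    finally show ?thesis unfolding ws(2) .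
  qed
  ultimately show ?thesis unfolding rooted_le_def by blast
qed

lemma rooted_le_Un_branches:
  assumes "finite S" "S \<subseteq> nbrs x" "x \<in> C"
    and W: "rooted_le (Suc k) W x" "W \<subseteq> C" and "\<And>v. v \<in> S \<Longrightarrow> W \<inter> B x v = {}"
    and light: "\<And>v. v \<in> S \<Longrightarrow> lmw_le R (B x v - {v}) k"
  shows "rooted_le (Suc k) (W \<union> (\<Union>v\<in>S. B x v)) x"
  using assms(1,2,6,7)
proof (induction S rule: finite_induct)
  case empty
  then show ?case using W by simp
next
  case (insert v S)
  have "rooted_le (Suc k) ((W \<union> (\<Union>v\<in>S. B x v)) \<union> B x v) x"
  proof (rule rooted_le_Un_branch)
    show "rooted_le (Suc k) (W \<union> (\<Union>v\<in>S. B x v)) x" using insert by auto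
    show "W \<union> (\<Union>v\<in>S. B x v) \<subseteq> C" using W(2) branch_subset insert.prems(1) by blast
    have "B x w \<inter> B x v = {}" if "w \<in> S" for w
      using branch_eqI insert.prems(1) insert.hyps(2) that by blast
    then show "(W \<union> (\<Union>v\<in>S. B x v)) \<inter> B x v = {}" using insert.prems(2) by blast
  qed (use insert.prems assms(3) in auto)
  then show ?case by (simp add: Un_ac)
qed

text \<open>Besides \<open>y\<close>, only the neighbour \<open>z\<close> may have a wide branch.
  Its rooted layout is prolonged by \<open>x\<close> and kept at the far end, and the light branches
  are inserted behind \<open>x\<close>. If \<open>z\<close> is no such neighbour, the construction
  starts from \<open>x\<close> alone.\<close>

lemma rooted_le_branch:
  assumes "x \<in> C" "y \<in> nbrs x"
    and light: "\<And>v. v \<in> nbrs x - {y, z} \<Longrightarrow> lmw_le R (B x v - {v}) k"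
    and z: "z \<in> nbrs x \<Longrightarrow> z \<noteq> y \<Longrightarrow> rooted_le (Suc k) (B x z) z"
  shows "rooted_le (Suc k) (B y x) x"
proof -
  define W where "W = (if z \<in> nbrs x - {y} then insert x (B x z) else {x})"
  have "rooted_le (Suc k) (W \<union> (\<Union>v\<in>nbrs x - {y, z}. B x v)) x"
  proof (rule rooted_le_Un_branches)
    show "rooted_le (Suc k) W x"
      using rooted_le_single rooted_le_Cons[OF assms(1)] z by (auto simp: W_def)
    show "W \<subseteq> C" using assms(1) branch_subset by (auto simp: W_def)
    show "W \<inter> B x v = {}" if "v \<in> nbrs x - {y, z}" for v
    proof -
      have v: "v \<in> nbrs x" "v \<noteq> z" using that by auto
      then have "x \<notin> B x v" using branch_subset by blast
      moreover have "B x z \<inter> B x v = {}" if "z \<in> nbrs x" using branch_eqI[OF that v(1)] v(2) by blast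
      ultimately show ?thesis by (simp add: W_def)
    qed
  qed (use finite_nbrs assms(1) light in auto)
  moreover have "W \<union> (\<Union>v\<in>nbrs x - {y, z}. B x v) = insert x (\<Union>v\<in>nbrs x - {y}. B x v)"
    by (auto simp: W_def)
  ultimately show ?thesis
    using branch_unfold[of y x] nbrs_sym[OF assms(1,2)] nbrsD[OF assms(2)] by simp
qed

text \<open>One of the layouts is reversed so that it ends at \<open>y\<close>, next to the start
  \<open>x\<close> of the other. Only the edge between these two joins the sides, and it crosses
  just the middle cut.\<close>

lemma lmw_le_join:
  assumes "x \<in> C" "y \<in> nbrs x" "rooted_le (Suc k) (B x y) y" "rooted_le (Suc k) (B y x) x"
  shows "lmw_le R C (Suc k)"
proof -
  obtain xs where xs: "distinct (x # xs)" "set (x # xs) = B y x" "layout_le R (x # xs) (Suc k)"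
    using assms(4) unfolding rooted_le_def by blast
  obtain ys where ys: "distinct (y # ys)" "set (y # ys) = B x y" "layout_le R (y # ys) (Suc k)"
    using assms(3) unfolding rooted_le_def by blast
  note disj = branch_opposite_disjoint[OF assms(1,2)]
  have only: "a = y \<and> b = x" if "a \<in> B x y" "b \<in> B y x" "R a b" for a b
    using branch_exit[OF assms(2) that(1,3)] that(2) disj branch_subset[OF nbrs_sym[OF assms(1,2)]] by blast
  have sets: "set (rev (y # ys)) = B x y" using ys(2) by simp
  have "layout_le R (rev (y # ys) @ (x # xs)) (Suc k)"
  proof (rule layout_le_append)
    show "layout_le R (rev (y # ys)) (Suc k)" using layout_le_rev[OF symp ys(3)] .
    have "cut_le R (B x y \<inter> {}) (B y x \<inter> {}) k" by simp
    then have "cut_le R (B x y) (B y x) (Suc k)"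
      by (rule cut_le_Suc[of _ _ "{}"]) (use only in blast)
    then show "cut_le R (set (rev (y # ys))) (set (x # xs)) (Suc k)" unfolding sets xs(2) .
    show "\<not> R a b" if "a \<in> set (butlast (rev (y # ys)))" "b \<in> set (x # xs)" for a b
    proof -
      have "a \<in> set ys" using that(1) by (simp add: butlast_append)
      then have "a \<in> B x y" "a \<noteq> y" using ys(1,2) by auto
      then show ?thesis using only that(2) xs(2) by blast
    qed
    show "\<not> R a b" if "a \<in> set (rev (y # ys))" "b \<in> set (tl (x # xs))" for a b
    proof -
      have "b \<in> B y x" "b \<noteq> x" using that(2) xs(1,2) by auto
      then show ?thesis using only that(1) sets by blast
    qed
  qed (use xs in simp)
  moreover have "distinct (rev (y # ys) @ (x # xs))" using xs(1,2) ys(1,2) disj by auto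
  moreover have "set (rev (y # ys) @ (x # xs)) = C"
    unfolding set_append sets xs(2) by (rule branch_Un_opposite[OF assms(1,2)])
  ultimately show ?thesis unfolding lmw_le_def by blast
qed

section \<open>Heavy neighbours and the lower bound for trees\<close>

definition heavy :: "nat \<Rightarrow> 'a \<Rightarrow> 'a \<Rightarrow> bool" where
  "heavy k x v \<longleftrightarrow> (\<exists>u\<in>nbrs v - {x}. \<not> lmw_le (square R) (B v u) k)"

text \<open>A path from \<open>B x v\<close> to \<open>B w u\<close> passes through
  \<open>v\<close>, \<open>x\<close>, \<open>w\<close> and \<open>u\<close> in this order, so the
  distance is at least three.\<close>

lemma not_square_branches:
  assumes "x \<in> C" "v \<in> nbrs x" "w \<in> nbrs x" "v \<noteq> w" "u \<in> nbrs w - {x}" "a \<in> B x v" "b \<in> B w u"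
  shows "a \<noteq> b \<and> \<not> square R a b"
proof -
  have b: "b \<in> B x w" using branch_psubset[OF assms(1,3)] assms(5,7) by blast
  have C: "a \<in> C" "b \<in> C" using branch_subset b assms(2,3,6) by blast+
  have nin: "c \<notin> B x w" if "c \<in> insert x (B x v)" for c
    using that branch_subset[OF assms(3)] branch_eqI[OF assms(2,3)] assms(4) by blast
  have "a \<noteq> b" using nin b assms(6) by blast
  moreover have "\<not> square R a b"
  proof
    assume "square R a b"
    then consider "R a b" | c where "c \<in> C" "R a c" "R c b"
      using square_in_conn[OF conn C] by blast
    then show False
    proof cases
      case 1
      then have "b \<in> insert x (B x v)" using branch_exit[OF assms(2,6) _ C(2)] by blast
      then show False using nin b by blast
    next
      case 2
      \<comment> \<open>A midpoint would be at most one step outside each of the two branches, hence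
        on both sides of the edge from \<open>x\<close> to \<open>w\<close>.\<close>
      have "c \<in> insert x (B x v)" using branch_exit[OF assms(2,6) 2(2,1)] by blast
      moreover have "c \<in> insert w (B w u)"
        using branch_exit[of u w b c] assms(5,7) 2 sym by blast
      moreover have "insert w (B w u) \<subseteq> B x w" using branch_psubset[OF assms(1,3)] assms(5) by auto
      ultimately show False using nin by blast
    qed
  qed
  ultimately show ?thesis by blast
qed

text \<open>Each heavy neighbour supplies a wide branch one step further out. Two full branches at
  \<open>x\<close> are linked in the square without \<open>x\<close>, their roots being at distance
  two; leaving out \<open>x\<close> keeps this set at distance three from the third wide branch, as
  \<open>not_lmw_le_Suc\<close> requires.\<close>

lemma at_most_two_heavy:
  assumes "lmw_le (square R) C (Suc k)" "x \<in> C"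
    and v: "v0 \<in> nbrs x" "v1 \<in> nbrs x" "v2 \<in> nbrs x" "v0 \<noteq> v1" "v0 \<noteq> v2" "v1 \<noteq> v2"
    and heavy: "heavy k x v0" "heavy k x v1" "heavy k x v2"
  shows False
proof -
  define f where "f i = (if i = 0 then v0 else if i = 1 then v1 else v2)" for i :: nat
  have f: "f i \<in> nbrs x" "heavy k x (f i)" for i using v heavy by (auto simp: f_def)
  have inj: "f i \<noteq> f j" if "i < 3" "j < 3" "i \<noteq> j" for i j
    using that v by (auto simp: f_def)
  obtain g where g: "g i \<in> nbrs (f i) - {x}" "\<not> lmw_le (square R) (B (f i) (g i)) k" for i
    using f(2) unfolding heavy_def by metis
  have sub: "B (f i) (g i) \<subseteq> B x (f i)" for i
    using branch_psubset[OF assms(2) f(1)] g(1) by blast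
  have "\<not> lmw_le (square R) C (Suc k)"
  proof (rule not_lmw_le_Suc[OF symp_square[OF symp]])
    show "\<not> lmw_le (square R) (B (f i) (g i)) k" for i by (rule g(2))
    show "B (f i) (g i) \<subseteq> C" for i using sub branch_subset f(1) by blast
    fix i j l :: nat assume ijl: "i < 3" "j < 3" "l < 3" "i \<noteq> j" "i \<noteq> l" "j \<noteq> l"
    let ?D = "B x (f j) \<union> B x (f l)"
    have "conn (square R) (B x (f i))" for i
      using conn_branch[OF f(1)] by (rule conn_mono) (use irrefl in \<open>auto simp: square_def\<close>)
    moreover have "square R (f j) (f l)" "square R (f l) (f j)"
      using nbrsD[OF f(1)] inj[OF ijl(2,3,6)] unfolding square_def by metis+
    ultimately have "conn (square R) ?D" by (intro conn_Un[OF _ _ root_in_branch root_in_branch]) auto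
    moreover have "?D \<subseteq> C" using branch_subset f(1) by blast
    moreover have "\<forall>a\<in>?D. \<forall>b\<in>B (f i) (g i). a \<noteq> b \<and> \<not> square R a b"
      using not_square_branches[OF assms(2) f(1) f(1) _ g(1)] inj ijl by blast
    ultimately show "\<exists>D. B (f j) (g j) \<subseteq> D \<and> B (f l) (g l) \<subseteq> D \<and> D \<subseteq> C \<and> conn (square R) D \<and>
        (\<forall>a\<in>D. \<forall>b\<in>B (f i) (g i). a \<noteq> b \<and> \<not> square R a b)"
      by (intro exI[of _ ?D]) (simp add: le_supI1 le_supI2 sub)
  qed
  then show False using assms(1) by blast
qed

lemma lmw_le_light:
  assumes "x \<in> C" "v \<in> nbrs x" "\<And>u. u \<in> nbrs v - {x} \<Longrightarrow> lmw_le R (B v u) k"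
  shows "lmw_le R (B x v - {v}) k"
proof -
  have "B x v - {v} = (\<Union>u\<in>nbrs v - {x}. B v u)"
    using branch_unfold[OF assms(1,2)] branch_subset by blast
  moreover have "lmw_le R (\<Union>u\<in>nbrs v - {x}. B v u) k"
  proof (rule lmw_le_UN)
    fix i j assume ij: "i \<in> nbrs v - {x}" "j \<in> nbrs v - {x}" "i \<noteq> j"
    then show disj: "B v i \<inter> B v j = {}" using branch_eqI by blast
    show "\<not> R a b" if "a \<in> B v i" "b \<in> B v j" for a b
      using branch_exit[of i v a b] branch_subset[of j v] that disj ij by blast
  qed (use assms finite_nbrs in auto)
  ultimately show ?thesis by simp
qed

text \<open>If two branches at \<open>x\<close> other than the one towards \<open>p\<close> are heavy, then no further
  branch is, and joining their rooted layouts through \<open>x\<close> lays out all of \<open>C\<close>.\<close>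

lemma rooted_le_or_lmw_le:
  assumes sq: "lmw_le (square R) C (Suc k)"
    and IH: "\<And>v u. \<lbrakk>v \<in> C; u \<in> nbrs v; lmw_le (square R) (B v u) k\<rbrakk> \<Longrightarrow> lmw_le R (B v u) k"
    and no: "\<not> lmw_le R C (Suc k)"
    and "x \<in> C" "p \<in> nbrs x"
  shows "rooted_le (Suc k) (B p x) x"
  using assms(4,5)
proof (induction "card (B p x)" arbitrary: p x rule: less_induct)
  case less
  note x = less.prems(1) and p = less.prems(2)
  have light: "lmw_le R (B x v - {v}) k" if "v \<in> nbrs x" "\<not> heavy k x v" for v
  proof (rule lmw_le_light[OF x that(1)])
    fix u assume "u \<in> nbrs v - {x}"
    then show "lmw_le R (B v u) k" using that(2) nbrsD[OF that(1)] IH unfolding heavy_def by blast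
  qed
  have rooted: "rooted_le (Suc k) (B x y) y" if "y \<in> nbrs x - {p}" for y
  proof (rule less.hyps)
    have y: "y \<in> nbrs x" "y \<noteq> p" using that by auto
    have "p \<in> C" using nbrsD[OF p] by blast
    then have "B x y \<subset> B p x" using nbrs_sym[OF x p] y by (rule branch_psubset)
    moreover have "finite (B p x)"
      using branch_subset[OF nbrs_sym[OF x p]] fin by (meson finite_Diff finite_subset)
    ultimately show "card (B x y) < card (B p x)" by (rule psubset_card_mono[rotated])
    show "y \<in> C" using nbrsD[OF y(1)] by blast
    show "x \<in> nbrs y" using nbrs_sym[OF x y(1)] .
  qed
  \<comment> \<open>Either at most one neighbour besides \<open>p\<close> is heavy, and it takes the
    role of \<open>z\<close> (arbitrary if there is none), or two of them are.\<close>
  show ?case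
  proof (cases "\<exists>z. \<forall>v\<in>nbrs x - {p}. heavy k x v \<longrightarrow> v = z")
    case True
    then obtain z where "\<forall>v\<in>nbrs x - {p}. heavy k x v \<longrightarrow> v = z" by blast
    then show ?thesis using light rooted by (intro rooted_le_branch[OF x p, of z]) auto
  next
    case False
    then obtain y z where yz: "y \<in> nbrs x - {p}" "heavy k x y" "z \<in> nbrs x - {p}" "heavy k x z" "y \<noteq> z"
      by metis
    \<comment> \<open>Now every other neighbour, including \<open>p\<close>, is light. The part of
      the tree away from \<open>y\<close> gets a rooted layout with the branch of \<open>z\<close>
      at its far end, and joining it to that of \<open>y\<close> covers all of \<open>C\<close>,
      against \<open>no\<close>.\<close>
    have "\<not> heavy k x v" if "v \<in> nbrs x - {y, z}" for v
      using at_most_two_heavy[OF sq x, of y z v] yz that by blast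
    then have "rooted_le (Suc k) (B y x) x"
      using light rooted yz by (intro rooted_le_branch[OF x, of y z]) auto
    then have "lmw_le R C (Suc k)" using lmw_le_join[OF x] rooted yz(1) by blast
    then show ?thesis using no by blast
  qed
qed

text \<open>If no layout of width \<open>k\<close> existed, \<open>rooted_le_or_lmw_le\<close> would
  give rooted layouts of both sides of any edge, and these join to a layout of \<open>C\<close>
  after all.\<close>

lemma lmw_le_of_square_step:
  assumes sq: "lmw_le (square R) C k"
    and less: "\<And>D j. \<lbrakk>card D < card C; conn R D; finite D; lmw_le (square R) D j\<rbrakk> \<Longrightarrow> lmw_le R D j"
  shows "lmw_le R C k"
proof (cases "\<exists>x\<in>C. nbrs x \<noteq> {}")
  case False
  \<comment> \<open>A connected set without edges has at most one vertex.\<close>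
  have "C = {x}" if "x \<in> C" for x using branch_cover[OF that] that False by blast
  then show ?thesis
    by (metis all_not_in_conv distinct_singleton layout_le_single lmw_le_def lmw_le_empty
        empty_set list.simps(15))
next
  case True
  then obtain x y where xy: "x \<in> C" "y \<in> nbrs x" by blast
  have "square R x y" "square R y x" using nbrsD[OF xy(2)] by (auto simp: square_def)
  \<comment> \<open>The edge makes \<open>k\<close> a successor, so that branches can be compared
    with width \<open>k - 1\<close> in the definition of heaviness.\<close>
  then have "k \<noteq> 0"
    using not_lmw_le_0[of x C y "square R"] sq xy nbrsD by (metis (full_types))
  then obtain j where k: "k = Suc j" by (cases k) auto
  show ?thesis
  proof (rule ccontr)
    assume no: "\<not> ?thesis"
    have IH: "lmw_le R (B v u) j" if "v \<in> C" "u \<in> nbrs v" "lmw_le (square R) (B v u) j" for v u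
    proof (rule less)
      have "B v u \<subset> C" using branch_subset[OF that(2)] that(1) by blast
      then show "card (B v u) < card C" by (rule psubset_card_mono[OF fin])
      show "finite (B v u)" using finite_subset[OF psubset_imp_subset[OF \<open>B v u \<subset> C\<close>] fin] .
    qed (rule conn_branch[OF that(2)], rule that(3))
    have rooted: "rooted_le (Suc j) (B p x) x" if "x \<in> C" "p \<in> nbrs x" for x p
    proof (rule rooted_le_or_lmw_le[of j])
      show "lmw_le (square R) C (Suc j)" using sq unfolding k .
      show "\<not> lmw_le R C (Suc j)" using no unfolding k .
    qed (fact IH, fact that(1), fact that(2))
    have "y \<in> C" using nbrsD[OF xy(2)] by blast
    then have "lmw_le R C (Suc j)"
      using xy nbrs_sym[OF xy] by (intro lmw_le_join[OF xy] rooted)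
    then show False using no unfolding k by blast
  qed
qed

end

text \<open>The width stays general in the induction on size, because the hypothesis is applied to
  branches with the width lowered by one.\<close>

theorem (in forest) lmw_le_of_square:
  assumes "conn R C" "finite C" "lmw_le (square R) C k"
  shows "lmw_le R C k"
  using assms
proof (induction "card C" arbitrary: C k rule: less_induct)
  case less
  have "subtree R C" using less.prems by (intro subtree.intro subtree_axioms.intro forest_axioms)
  then show ?case using less.prems(3) less.hyps by (rule subtree.lmw_le_of_square_step)
qed

section \<open>Graphs and relations\<close>

text \<open>The last conclusion keeps track of what the relation says about the vertices of the
  path; the conversion of trees reads off from it that they lie in \<open>V\<close> and avoid a
  given vertex.\<close>

lemma rtranclp_imp_path:
  assumes "r\<^sup>*\<^sup>* v w"
  obtains p where "p \<noteq> []" "hd p = v" "last p = w" "distinct p" "successively r p" "\<forall>a\<in>set p. r\<^sup>*\<^sup>* a w"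
proof -
  have "\<exists>p. p \<noteq> [] \<and> hd p = v \<and> last p = w \<and> distinct p \<and> successively r p \<and> (\<forall>a\<in>set p. r\<^sup>*\<^sup>* a w)"
    using assms
  proof (induction rule: converse_rtranclp_induct)
    case base
    show ?case by (rule exI[of _ "[w]"]) simp
  next
    case (step y z)
    then obtain p where p: "p \<noteq> []" "hd p = z" "last p = w" "distinct p" "successively r p" "\<forall>a\<in>set p. r\<^sup>*\<^sup>* a w"
      by blast
    show ?case
    proof (cases "y \<in> set p")
      case True
      then obtain as bs where "p = as @ y # bs" by (meson split_list)
      then show ?thesis using p by (intro exI[of _ "y # bs"]) (auto simp: successively_append_iff)
    next
      case False
      have "r\<^sup>*\<^sup>* y w" using step by (meson converse_rtranclp_into_rtranclp)
      then show ?thesis using p False step(1)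
        by (intro exI[of _ "y # p"]) (auto simp: successively_Cons)
    qed
  qed
  then show ?thesis using that by blast
qed

lemma successively_imp_rtranclp: "successively r p \<Longrightarrow> p \<noteq> [] \<Longrightarrow> r\<^sup>*\<^sup>* (hd p) (last p)"
proof (induction p)
  case (Cons x p)
  then show ?case
    by (cases "p = []") (auto simp: successively_Cons intro: converse_rtranclp_into_rtranclp)
qed simp

text \<open>A path between distinct neighbours of \<open>x\<close> that avoids \<open>x\<close>
  closes up through \<open>x\<close> to a cycle of length at least three.\<close>

lemma is_tree_imp_forest:
  assumes "is_tree V E"
  shows "forest (adj E)"
proof
  have V: "simple_graph V E" using assms by (simp add: is_tree_def)
  show "symp (adj E)" by (rule symp_adj)
  show "\<not> adj E x x" for x using simple_graph_adj(3)[OF V] by blast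
  fix x v w
  assume xv: "adj E x v" and xw: "adj E x w" and vw: "(\<lambda>a b. adj E a b \<and> a \<noteq> x \<and> b \<noteq> x)\<^sup>*\<^sup>* v w"
  let ?r = "\<lambda>a b. adj E a b \<and> a \<noteq> x \<and> b \<noteq> x"
  obtain p where p: "p \<noteq> []" "hd p = v" "last p = w" "distinct p" "successively ?r p" "\<forall>a\<in>set p. ?r\<^sup>*\<^sup>* a w"
    using rtranclp_imp_path[OF vw] .
  show "v = w"
  proof (rule ccontr)
    assume "v \<noteq> w"
    \<comment> \<open>Either the path vertex is \<open>w\<close>, or it has a further restricted
      step, which places it in \<open>V\<close> and away from \<open>x\<close>.\<close>
    have "a \<in> V \<and> a \<noteq> x" if "a \<in> set p" for a
      using p(6)[rule_format, OF that]
    proof (cases rule: converse_rtranclpE)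
      case base
      then show ?thesis using simple_graph_adj[OF V xw] by auto
    next
      case (step y)
      then show ?thesis using simple_graph_adj[OF V] by blast
    qed
    moreover have "length p \<ge> 2"
      using p(1-3) \<open>v \<noteq> w\<close> by (cases p; cases "tl p") auto
    moreover have "successively (adj E) (x # p)"
      using p(1,2,5) xv by (auto simp: successively_Cons elim: successively_mono)
    ultimately have "is_cycle V E (x # p)"
      unfolding is_cycle_def successively_conv_nth
      using p(1,3,4) simple_graph_adj(1)[OF V xv] xw symp_adj[of E] by (auto dest: sympD)
    then show False using assms by (auto simp: is_tree_def)
  qed
qed

lemma is_tree_imp_conn: "is_tree V E \<Longrightarrow> conn (adj E) V"
  by (simp add: is_tree_def connected_graph_def conn_def)

definition edges_on :: "('a \<Rightarrow> 'b) \<Rightarrow> 'a set \<Rightarrow> ('a \<Rightarrow> 'a \<Rightarrow> bool) \<Rightarrow> 'b set set" where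
  "edges_on f W R = {{f u, f v} | u v. u \<in> W \<and> v \<in> W \<and> R u v}"

lemma conn_image:
  assumes "conn R W" "\<And>u v. u \<in> W \<Longrightarrow> v \<in> W \<Longrightarrow> R u v \<Longrightarrow> R' (f u) (f v)"
  shows "conn R' (f ` W)"
  unfolding conn_def
proof (intro ballI, elim imageE, simp)
  fix a b assume "a \<in> W" "b \<in> W"
  then have "(\<lambda>x y. R x y \<and> x \<in> W \<and> y \<in> W)\<^sup>*\<^sup>* a b" using assms(1) by (simp add: conn_def)
  then show "(\<lambda>x y. R' x y \<and> x \<in> f ` W \<and> y \<in> f ` W)\<^sup>*\<^sup>* (f a) (f b)"
  proof (induction rule: rtranclp_induct)
    case (step y z)
    then have "R' (f y) (f z) \<and> f y \<in> f ` W \<and> f z \<in> f ` W" using assms(2) by blast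
    with step.IH show ?case by (rule rtranclp.rtrancl_into_rtrancl)
  qed simp
qed

text \<open>A cycle in the image pulls back to a vertex and a path avoiding it whose ends are both
  its neighbours; these ends coincide, against distinctness. For the square, the image graph only
  sees midpoints in \<open>W\<close>.\<close>

lemma (in forest) tree_of_forest:
  assumes "inj f" "finite W" "W \<noteq> {}" "conn R W"
  shows "is_tree (f ` W) (edges_on f W R)"
    and "lmw (f ` W) (edges_on f W R) \<le> k \<longleftrightarrow> lmw_le R W k"
    and "lmw (f ` W) (graph_square (f ` W) (edges_on f W R)) \<le> k \<longleftrightarrow> lmw_le (square R) W k"
proof -
  let ?E = "edges_on f W R"
  have adj: "adj ?E (f u) (f v) \<longleftrightarrow> u \<in> W \<and> v \<in> W \<and> R u v" for u v
    using assms(1) sym by (auto simp: adj_def edges_on_def doubleton_eq_iff inj_eq)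
  have simple: "simple_graph (f ` W) ?E"
    using assms(1,2) irrefl unfolding simple_graph_def edges_on_def
    by (fastforce simp: inj_eq)
  have "\<not> is_cycle (f ` W) ?E cs" for cs
  proof
    assume cyc: "is_cycle (f ` W) ?E cs"
    then have "set cs \<subseteq> f ` W" by (simp add: is_cycle_def)
    then obtain ds where cs: "cs = map f ds"
      by (metis ex_map_conv image_iff subsetD)
    then obtain x p where ds: "ds = x # p" "length p \<ge> 2"
      using cyc by (cases ds) (auto simp: is_cycle_def)
    have "distinct ds" using cyc cs by (auto simp: is_cycle_def distinct_map)
    moreover have "successively R ds" unfolding successively_conv_nth
    proof (intro allI impI)
      fix i assume "Suc i < length ds"
      then have "adj ?E (f (ds ! i)) (f (ds ! Suc i))"
        using cyc unfolding is_cycle_def cs by auto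
      then show "R (ds ! i) (ds ! Suc i)" using adj by blast
    qed
    moreover have "R (last ds) (hd ds)"
    proof -
      have "adj ?E (f (last ds)) (f (hd ds))"
        using cyc ds(1) unfolding is_cycle_def cs by (metis hd_map last_map list.distinct(1))
      then show ?thesis using adj by blast
    qed
    moreover have "p \<noteq> []" using ds(2) by auto
    ultimately have p: "successively R p" "x \<notin> set p" "distinct p" "R x (hd p)" "R x (last p)"
      using ds(1) sym by (simp_all add: successively_Cons)
    have "successively (\<lambda>a b. R a b \<and> a \<noteq> x \<and> b \<noteq> x) p"
      using p(1) by (rule successively_mono) (use p(2) in auto)
    then have "(\<lambda>a b. R a b \<and> a \<noteq> x \<and> b \<noteq> x)\<^sup>*\<^sup>* (hd p) (last p)"
      using ds(2) by (intro successively_imp_rtranclp) auto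
    then have "hd p = last p" using acyclic p(4,5) by blast
    moreover obtain a q where "p = a # q" "q \<noteq> []" using ds(2) by (cases p) fastforce+
    ultimately show False using p(3) last_in_set[of q] by simp
  qed
  moreover have "connected_graph (f ` W) ?E"
    using conn_image[OF assms(4), of "adj ?E" f] adj by (simp add: conn_def connected_graph_def)
  ultimately show "is_tree (f ` W) ?E"
    using simple assms(3) by (simp add: is_tree_def)
  have inj: "inj_on f W" using assms(1) by (rule inj_on_subset) simp
  show "lmw (f ` W) ?E \<le> k \<longleftrightarrow> lmw_le R W k"
    unfolding lmw_le_iff[OF simple] using adj by (intro lmw_le_map_iff[OF inj]) simp
  have "square (adj ?E) (f u) (f v) \<longleftrightarrow> square R u v" if uv: "u \<in> W" "v \<in> W" for u v
  proof
    assume *: "square (adj ?E) (f u) (f v)"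
    then show "square R u v"
    proof (cases "adj ?E (f u) (f v)")
      case True
      then show ?thesis using * adj by (auto simp: square_def)
    next
      case False
      then obtain w where w: "adj ?E (f u) w" "adj ?E w (f v)" using * by (auto simp: square_def)
      then obtain w' where "w = f w'" using simple_graph_adj(2)[OF simple w(1)] by blast
      then show ?thesis using w * adj by (auto simp: square_def)
    qed
  next
    \<comment> \<open>Connectedness of \<open>W\<close> moves the midpoint into
      \<open>W\<close>.\<close>
    assume *: "square R u v"
    then consider "R u v" | w where "w \<in> W" "R u w" "R w v"
      using square_in_conn[OF assms(4) uv *] by blast
    then have "adj ?E (f u) (f v) \<or> (\<exists>w. adj ?E (f u) w \<and> adj ?E w (f v))"
      using adj uv by metis
    then show "square (adj ?E) (f u) (f v)"
      using * assms(1) by (simp add: square_def inj_eq)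
  qed
  then show "lmw (f ` W) (graph_square (f ` W) ?E) \<le> k \<longleftrightarrow> lmw_le (square R) W k"
    unfolding lmw_le_iff[OF simple_graph_square[OF finite_imageI[OF assms(2)]]] adj_graph_square[OF simple]
    by (rule lmw_le_map_iff[OF inj])
qed

section \<open>Connected sets and layouts arranged around a centre\<close>

lemma conn_UN:
  assumes "\<And>i. i \<in> I \<Longrightarrow> conn R (D i)" "\<And>i. i \<in> I \<Longrightarrow> c \<in> D i"
  shows "conn R (\<Union>i\<in>I. D i)"
  unfolding conn_def
proof (intro ballI)
  let ?r = "\<lambda>x y. R x y \<and> x \<in> (\<Union>i\<in>I. D i) \<and> y \<in> (\<Union>i\<in>I. D i)"
  have 1: "?r\<^sup>*\<^sup>* x y" if "i \<in> I" "x \<in> D i" "y \<in> D i" for i x y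
  proof -
    have "(\<lambda>x y. R x y \<and> x \<in> D i \<and> y \<in> D i)\<^sup>*\<^sup>* x y" using assms(1) that by (simp add: conn_def)
    then show ?thesis by (rule rtranclp_weaken) (use that(1) in blast)
  qed
  fix a b assume "a \<in> (\<Union>i\<in>I. D i)" "b \<in> (\<Union>i\<in>I. D i)"
  then have "?r\<^sup>*\<^sup>* a c" "?r\<^sup>*\<^sup>* c b" using 1 assms(2) by blast+
  then show "?r\<^sup>*\<^sup>* a b" by (rule rtranclp_trans)
qed

lemma conn_star:
  assumes "symp R" "\<And>i. i \<in> I \<Longrightarrow> conn R (D i)" "\<And>i. i \<in> I \<Longrightarrow> d i \<in> D i" "\<And>i. i \<in> I \<Longrightarrow> R c (d i)"
  shows "conn R (insert c (\<Union>i\<in>I. D i))"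
proof (cases "I = {}")
  case False
  have "conn R ({c} \<union> D i)" if "i \<in> I" for i
    using assms(2-4)[OF that] sympD[OF assms(1)] by (intro conn_Un[of R "{c}" "D i" c "d i"]) auto
  then have "conn R (\<Union>i\<in>I. {c} \<union> D i)" by (rule conn_UN) auto
  moreover have "(\<Union>i\<in>I. {c} \<union> D i) = insert c (\<Union>i\<in>I. D i)" using False by auto
  ultimately show ?thesis by simp
qed simp

text \<open>The layout is the centre \<open>c\<close>, then each block \<open>U v\<close> followed
  by its hub \<open>v\<close>. By \<open>cross\<close>, either no edges join different blocks or
  they join only hubs, which then form a clique. The first case serves trees, the second
  squares.\<close>

lemma lmw_le_star:
  assumes "finite H"
    and U: "\<And>v. v \<in> H \<Longrightarrow> lmw_le R (U v) k"
    and vU: "\<And>v. v \<in> H \<Longrightarrow> v \<notin> U v"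
    and disj: "\<And>v w. v \<in> H \<Longrightarrow> w \<in> H \<Longrightarrow> v \<noteq> w \<Longrightarrow> insert v (U v) \<inter> insert w (U w) = {}"
    and c: "\<And>v. v \<in> H \<Longrightarrow> c \<notin> insert v (U v)"
    and hub: "\<And>v. v \<in> H \<Longrightarrow> R c v"
    and cross: "\<And>v w a b. \<lbrakk>v \<in> H; w \<in> H; v \<noteq> w; a \<in> insert v (U v); b \<in> insert w (U w); R a b\<rbrakk> \<Longrightarrow>
      a = v \<and> b = w \<and> (\<forall>v'\<in>H. \<forall>w'\<in>H. v' \<noteq> w' \<longrightarrow> R v' w')"
  shows "lmw_le R (insert c (\<Union>v\<in>H. insert v (U v))) (Suc k)"
proof -
  obtain L where L: "distinct (L v)" "set (L v) = U v" "layout_le R (L v) k" if "v \<in> H" for v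
    using U unfolding lmw_le_def by metis
  let ?bl = "\<lambda>vs. concat (map (\<lambda>v. L v @ [v]) vs)"
  let ?A = "\<lambda>J. insert c (\<Union>v\<in>J. insert v (U v))"
  have set_bl: "set (?bl vs) = (\<Union>v\<in>set vs. insert v (U v))" if "set vs \<subseteq> H" for vs
    using that by (induction vs) (auto simp: L(2))
  have after: "layout_after_le R (?A J) (?bl vs) (Suc k)"
    if "J \<subseteq> H" "set vs \<subseteq> H" "distinct vs" "J \<inter> set vs = {}" for J vs
    using that
  proof (induction vs arbitrary: J)
    case Nil
    then show ?case by simp
  next
    case (Cons v vs)
    have v: "v \<in> H" "v \<notin> J" "v \<notin> set vs" and vs: "set vs \<subseteq> H" using Cons.prems by auto
    have dJ: "insert v (U v) \<inter> insert w (U w) = {}" if "w \<in> J \<union> set vs" for w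
    proof -
      have "w \<in> H" "v \<noteq> w" using that v vs Cons.prems(1) by auto
      then show ?thesis by (rule disj[OF v(1)])
    qed
    have "layout_after_le R (?A J) (L v @ v # ?bl vs) (Suc k)"
    proof (rule layout_after_le_block[OF L(3)[OF v(1)]])
      have "?A J \<union> set (L v) \<union> {v} = ?A (insert v J)" using L(2)[OF v(1)] by auto
      moreover have "layout_after_le R (?A (insert v J)) (?bl vs) (Suc k)"
        using Cons.prems by (intro Cons.IH) auto
      ultimately show "layout_after_le R (?A J \<union> set (L v) \<union> {v}) (?bl vs) (Suc k)" by simp
      show "?A J \<inter> set (L v) = {}" using dJ c[OF v(1)] L(2)[OF v(1)] by blast
      show "v \<notin> set (L v)" using vU L(2) v(1) by blast
      show "set (?bl vs) \<inter> set (L v) = {}" unfolding set_bl[OF vs] using dJ L(2)[OF v(1)] by blast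
      \<comment> \<open>Outside the current block, a crossing edge starts at \<open>c\<close>, ends
        at the current hub \<open>v\<close>, or joins an earlier hub to a hub not yet placed; the
        last happens only if the hubs form a clique.\<close>
      define hub_edge where "hub_edge a b \<longleftrightarrow> a \<in> J \<and> b \<in> insert v (set vs) \<and>
        (\<forall>v'\<in>H. \<forall>w'\<in>H. v' \<noteq> w' \<longrightarrow> R v' w')" for a b
      have kinds: "a = c \<and> R c b \<or> b = v \<and> R a v \<or> hub_edge a b"
        if ab: "a \<in> ?A J \<union> set (L v)" "b \<in> set (L v) \<union> {v} \<union> set (?bl vs)" "R a b"
          "\<not> (a \<in> set (L v) \<and> b \<in> set (L v))" for a b
      proof -
        consider "a = c" | "b = v" | x where "x \<in> J" "a \<in> insert x (U x)" "b \<noteq> v"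
          | "a \<in> U v" "b \<noteq> v"
          using ab(1) L(2)[OF v(1)] by auto
        then show ?thesis
        proof cases
          case 3
          then obtain y where y: "y \<in> insert v (set vs)" "b \<in> insert y (U y)"
            using ab(2) unfolding set_bl[OF vs] L(2)[OF v(1)] by blast
          have "x \<in> H" "y \<in> H" "x \<noteq> y" using 3 y(1) v vs Cons.prems by auto
          then have "a = x \<and> b = y \<and> (\<forall>v'\<in>H. \<forall>w'\<in>H. v' \<noteq> w' \<longrightarrow> R v' w')"
            using 3(2) y(2) ab(3) by (rule cross)
          then show ?thesis using 3(1) y(1) unfolding hub_edge_def by blast
        next
          case 4
          then obtain y where y: "y \<in> set vs" "b \<in> insert y (U y)"
            using ab(2,4) unfolding set_bl[OF vs] L(2)[OF v(1)] by blast
          have "y \<in> H" "y \<noteq> v" using y(1) v vs by auto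
          then have "a = v" using cross[of v y a b] 4 v(1) y(2) ab(3) by blast
          then show ?thesis using 4(1) vU v(1) by blast
        qed (use ab(3) in auto)
      qed
      have hub_edgeD: "a \<in> H" "a \<noteq> v" "a \<notin> set vs" "b \<in> insert v (set vs)" "b \<in> H"
        "\<forall>v'\<in>H. \<forall>w'\<in>H. v' \<noteq> w' \<longrightarrow> R v' w'" if "hub_edge a b" for a b
        using that v Cons.prems unfolding hub_edge_def by auto
      have hubJ: "R a d" if "hub_edge a b" "hub_edge c' d" for a b c' d
        using hub_edgeD[OF that(1)] hub_edgeD(4,5)[OF that(2)] by auto
      have hubv: "R a v" if "hub_edge a b" for a b
        using hub_edgeD[OF that] v(1) by auto
      have hubc: "R c b" if "hub_edge a b" for a b
        using hub hub_edgeD(5)[OF that] by blast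
      fix a b c' d
      assume *: "a \<in> ?A J \<union> set (L v)" "b \<in> set (L v) \<union> {v} \<union> set (?bl vs)" "R a b"
        "\<not> (a \<in> set (L v) \<and> b \<in> set (L v))"
        "c' \<in> ?A J \<union> set (L v)" "d \<in> set (L v) \<union> {v} \<union> set (?bl vs)" "R c' d"
        "\<not> (c' \<in> set (L v) \<and> d \<in> set (L v))"
      \<comment> \<open>Any two of the three kinds conflict: \<open>c\<close> is adjacent to every
        hub, and distinct hubs are adjacent whenever a hub edge occurs.\<close>
      show "R a d \<or> R c' b"
        using kinds[OF *(1-4)] kinds[OF *(5-8)] hub[OF v(1)] hubJ hubv hubc by metis
    qed
    then show ?case by simp
  qed
  obtain vs where vs: "distinct vs" "set vs = H" using assms(1) finite_distinct_list by metis
  have "layout_le R (c # ?bl vs) (Suc k)"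
    using after[of "{}" vs] vs unfolding layout_le_Cons by simp
  moreover have "distinct (?bl ws)" if "distinct ws" "set ws \<subseteq> H" for ws
    using that
  proof (induction ws)
    case (Cons w ws)
    then have "insert w (U w) \<inter> insert v (U v) = {}" if "v \<in> set ws" for v
      using disj[of w v] that by auto
    moreover have ws: "set ws \<subseteq> H" "w \<in> H" using Cons.prems by auto
    ultimately have "insert w (U w) \<inter> set (?bl ws) = {}" unfolding set_bl[OF ws(1)] by blast
    then show ?case using Cons ws L(1,2)[OF ws(2)] vU[OF ws(2)] by auto
  qed simp
  moreover have bl: "set (?bl vs) = (\<Union>v\<in>H. insert v (U v))" using set_bl[of vs] vs(2) by blast
  moreover have "c \<notin> set (?bl vs)" unfolding bl using c by blast
  ultimately have "layout_le R (c # ?bl vs) (Suc k)" "distinct (c # ?bl vs)"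
    "set (c # ?bl vs) = insert c (\<Union>v\<in>H. insert v (U v))"
    using vs by (simp_all only: distinct.simps list.set) blast+
  then show ?thesis unfolding lmw_le_def by blast
qed

section \<open>Extremal trees\<close>

text \<open>The infinite tree that joins each word to its one-letter extensions, see
  \<open>word_adj_iff\<close>. Recursion from the front makes invariance under a common prefix a
  simplification rule.\<close>

fun word_adj :: "nat list \<Rightarrow> nat list \<Rightarrow> bool" where
  "word_adj [] [] \<longleftrightarrow> False"
| "word_adj [] (y # v) \<longleftrightarrow> v = []"
| "word_adj (x # u) [] \<longleftrightarrow> u = []"
| "word_adj (x # u) (y # v) \<longleftrightarrow> x = y \<and> word_adj u v"

lemma word_adj_iff: "word_adj u v \<longleftrightarrow> (\<exists>i. v = u @ [i] \<or> u = v @ [i])"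
  by (induction u v rule: word_adj.induct) (auto simp: Cons_eq_append_conv append_eq_Cons_conv)

lemma square_word_adj_simps [simp]:
  "\<not> square word_adj [] []"
  "square word_adj [] (y # v) \<longleftrightarrow> v = [] \<or> word_adj [] v"
  "square word_adj (x # u) [] \<longleftrightarrow> u = [] \<or> word_adj [] u"
  "square word_adj (x # u) (y # v) \<longleftrightarrow>
     (if x = y then square word_adj u v else u = [] \<and> v = [])"
proof -
  have ex: "(\<exists>w. P w) \<longleftrightarrow> P [] \<or> (\<exists>z w. P (z # w))" for P :: "nat list \<Rightarrow> bool"
    by (metis list.exhaust)
  have sym: "word_adj u v \<longleftrightarrow> word_adj v u" for u v
    by (auto simp: word_adj_iff)
  show "\<not> square word_adj [] []" by (simp add: square_def)
  show "square word_adj [] (y # v) \<longleftrightarrow> v = [] \<or> word_adj [] v" for y v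
    by (auto simp: square_def ex[where P = "\<lambda>w. word_adj [] w \<and> word_adj w v" for v])
  show "square word_adj (x # u) [] \<longleftrightarrow> u = [] \<or> word_adj [] u" for x u
    by (auto simp: square_def sym[of u] ex[where P = "\<lambda>w. word_adj u w \<and> word_adj w v" for u v])
  show "square word_adj (x # u) (y # v) \<longleftrightarrow>
     (if x = y then square word_adj u v else u = [] \<and> v = [])" for x u y v
    by (auto simp: square_def ex[where P = "\<lambda>w. word_adj (x # u) w \<and> word_adj w (y # v)"])
qed

text \<open>A walk that starts at a child of \<open>x\<close> and avoids \<open>x\<close> stays
  below that child, so it meets no other neighbour of \<open>x\<close>. If neither of two neighbours
  is a child, both are the unique parent.\<close>

lemma forest_word_adj: "forest word_adj"
proof
  let ?r = "\<lambda>x a b. word_adj a b \<and> a \<noteq> x \<and> b \<noteq> x"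
  show symp: "symp word_adj" by (auto simp: symp_def word_adj_iff)
  show "\<not> word_adj x x" for x by (simp add: word_adj_iff)
  have below: "\<exists>z. y = x @ i # z" if "(?r x)\<^sup>*\<^sup>* (x @ [i]) y" for x i y
    using that
  proof (induction rule: rtranclp_induct)
    case (step y y')
    then obtain z where z: "y = x @ i # z" by blast
    from step(2) consider a where "y' = y @ [a]" | a where "y = y' @ [a]" "y' \<noteq> x"
      by (auto simp: word_adj_iff)
    then show ?case
    proof cases
      case 2
      then show ?thesis using z by (cases z rule: rev_cases) auto
    qed (use z in auto)
  qed auto
  have child: "v = w" if h: "word_adj x w" "(?r x)\<^sup>*\<^sup>* v w" "v = x @ [i]" for x v w i
  proof -
    obtain z where "w = x @ i # z" using below[of x i w] h(2,3) by blast
    then show ?thesis using h(1,3) by (auto simp: word_adj_iff)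
  qed
  fix x v w assume *: "word_adj x v" "word_adj x w" "(?r x)\<^sup>*\<^sup>* v w"
  have "symp (?r x)" using symp by (auto simp: symp_def)
  then have wv: "(?r x)\<^sup>*\<^sup>* w v" by (rule sympD[OF symp_rtranclp *(3)])
  consider i where "v = x @ [i]" | i where "w = x @ [i]" | i j where "x = v @ [i]" "x = w @ [j]"
    using *(1,2) unfolding word_adj_iff by blast
  then show "v = w"
  proof cases
    case 1
    then show ?thesis using child[OF *(2,3)] by blast
  next
    case 2
    then show ?thesis using child[OF *(1) wv] by blast
  next
    case 3
    then show ?thesis by simp
  qed
qed

lemmas symp_word_adj = forest.symp[OF forest_word_adj]

lemma symp_square_word_adj: "symp (square word_adj)"
  using symp_square symp_word_adj .

lemma conn_square_word_adj: "conn word_adj W \<Longrightarrow> conn (square word_adj) W"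
  by (erule conn_mono) (use forest.irrefl[OF forest_word_adj] in \<open>auto simp: square_def\<close>)

text \<open>The root of copy \<open>i\<close> is \<open>[i, 0]\<close>, joined to the new root
  \<open>[]\<close> through the middle vertex \<open>[i]\<close>.\<close>

fun low_tree :: "nat \<Rightarrow> nat list set" where
  "low_tree 0 = {[]}"
| "low_tree (Suc k) = insert [] (\<Union>i\<in>{..<3}. insert [i] ((\<lambda>w. i # 0 # w) ` low_tree k))"

text \<open>The centre is \<open>[0]\<close>, its three neighbours \<open>[0, i]\<close> carry three
  copies each, and \<open>[]\<close> is a pendant vertex at the centre by which the tree is attached
  at the next level.\<close>

fun high_tree :: "nat \<Rightarrow> nat list set" where
  "high_tree 0 = {[]}"
| "high_tree (Suc k) = insert [] (insert [0]
     (\<Union>i\<in>{..<3}. insert [0, i] (\<Union>j\<in>{..<3}. (\<lambda>w. 0 # i # j # w) ` high_tree k)))"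

lemma Nil_in_low_tree [simp]: "[] \<in> low_tree k"
  by (cases k) auto

lemma Nil_in_high_tree [simp]: "[] \<in> high_tree k"
  by (cases k) auto

lemma finite_low_tree: "finite (low_tree k)"
  by (induction k) auto

lemma finite_high_tree: "finite (high_tree k)"
  by (induction k) auto

lemma conn_low_block:
  assumes "conn word_adj W" "[] \<in> W"
  shows "conn word_adj (insert [i] ((\<lambda>w. i # 0 # w) ` W))"
proof -
  have "conn word_adj (insert [i] (\<Union>j\<in>{0}. (\<lambda>w. i # j # w) ` W))"
    using assms by (intro conn_star[where d = "\<lambda>j. [i, j]"] symp_word_adj conn_image[OF assms(1)]) auto
  then show ?thesis by simp
qed

lemma conn_low_tree: "conn word_adj (low_tree k)"
proof (induction k)
  case (Suc k)
  then show ?case unfolding low_tree.simps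
    by (intro conn_star[where d = "\<lambda>i. [i]"] symp_word_adj conn_low_block) auto
qed simp

lemma conn_high_block:
  assumes "conn word_adj W" "[] \<in> W"
  shows "conn word_adj (insert [0, i] (\<Union>j\<in>J. (\<lambda>w. 0 # i # j # w) ` W))"
  using assms
  by (intro conn_star[where d = "\<lambda>j. [0, i, j]"] symp_word_adj conn_image[OF assms(1)]) auto

lemma conn_high_tree: "conn word_adj (high_tree k)"
proof (induction k)
  case (Suc k)
  let ?D = "insert [0] (\<Union>i\<in>{..<3}. insert [0, i] (\<Union>j\<in>{..<3}. (\<lambda>w. 0 # i # j # w) ` high_tree k))"
  have "conn word_adj ?D"
    using Suc by (intro conn_high_block conn_star[where d = "\<lambda>i. [0, i]"] symp_word_adj) auto
  then have "conn word_adj (insert [] (\<Union>i\<in>{0 :: nat}. ?D))"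
    by (rule conn_star[where d = "\<lambda>i. [0]", OF symp_word_adj]) auto
  then show ?case by simp
qed simp

lemma lmw_le_copy:
  assumes "inj f" "\<And>u v. R (f u) (f v) \<longleftrightarrow> R u v"
  shows "lmw_le R (f ` W) k \<longleftrightarrow> lmw_le R W k"
  using assms by (intro lmw_le_map_iff) (auto intro: inj_on_subset)

lemma lmw_le_single: "lmw_le R {x} k"
  unfolding lmw_le_def by (rule exI[of _ "[x]"]) simp

text \<open>\<open>lmw_le_star\<close> with centre \<open>[]\<close> and hubs \<open>[i]\<close>. In
  the square the hubs are pairwise adjacent, and no other edges join different blocks.\<close>

lemma lmw_square_low_tree: "lmw_le (square word_adj) (low_tree k) k"
proof (induction k)
  case 0
  show ?case by (simp add: lmw_le_single)
next
  case (Suc k)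
  let ?H = "(\<lambda>i. [i]) ` {..<3 :: nat}" and ?U = "\<lambda>v. (\<lambda>w. v @ 0 # w) ` low_tree k"
  have "lmw_le (square word_adj) (insert [] (\<Union>v\<in>?H. insert v (?U v))) (Suc k)"
  proof (rule lmw_le_star)
    show "lmw_le (square word_adj) (?U v) k" if "v \<in> ?H" for v
      using that Suc by (auto simp: lmw_le_copy inj_def)
  qed (auto split: if_splits)
  moreover have "insert [] (\<Union>v\<in>?H. insert v (?U v)) = low_tree (Suc k)" by simp
  ultimately show ?case by metis
qed

text \<open>Two copies are connected through \<open>[]\<close>; the middle vertex \<open>[i]\<close>
  is left out of this set and separates it from the third copy.\<close>

lemma not_lmw_low_tree: "\<not> lmw_le word_adj (low_tree (Suc k)) k"
proof (induction k)
  case 0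
  show ?case by (rule not_lmw_le_0[of "[]" _ "[0]"]) auto
next
  case (Suc k)
  let ?C = "\<lambda>i. (\<lambda>w. i # 0 # w) ` low_tree (Suc k)"
  show ?case
  proof (rule not_lmw_le_Suc[of _ ?C])
    show "\<not> lmw_le word_adj (?C i) k" for i
      using Suc by (subst lmw_le_copy) (auto simp: inj_def simp del: low_tree.simps)
    show "?C i \<subseteq> low_tree (Suc (Suc k))" if "i < 3" for i
      using that by (subst low_tree.simps) blast
    fix i j l :: nat assume ijl: "i < 3" "j < 3" "l < 3" "i \<noteq> j" "i \<noteq> l" "j \<noteq> l"
    let ?D = "insert [] (\<Union>m\<in>{j, l}. insert [m] (?C m))"
    have "conn word_adj ?D"
      by (intro conn_star[where d = "\<lambda>i. [i]"] symp_word_adj conn_low_block conn_low_tree) auto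
    moreover have "?D \<subseteq> low_tree (Suc (Suc k))"
      using ijl by (subst (2) low_tree.simps) blast
    moreover have "\<forall>a\<in>?D. \<forall>b\<in>?C i. a \<noteq> b \<and> \<not> word_adj a b"
      using ijl by (auto simp del: low_tree.simps)
    ultimately show "\<exists>D. ?C j \<subseteq> D \<and> ?C l \<subseteq> D \<and> D \<subseteq> low_tree (Suc (Suc k)) \<and> conn word_adj D \<and>
        (\<forall>a\<in>D. \<forall>b\<in>?C i. a \<noteq> b \<and> \<not> word_adj a b)"
      by (intro exI[of _ ?D]) (simp del: low_tree.simps add: le_supI1 le_supI2 subset_insertI2)
  qed (rule symp_word_adj)
qed

text \<open>\<open>lmw_le_star\<close> with centre \<open>[0]\<close>, whose hubs are the three
  \<open>[0, i]\<close> and the pendant vertex \<open>[]\<close> with an empty block. The three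
  copies at a hub are mutually unrelated, so together they need only the width of one.\<close>

lemma lmw_high_tree: "lmw_le word_adj (high_tree k) k"
proof (induction k)
  case 0
  show ?case by (simp add: lmw_le_single)
next
  case (Suc k)
  let ?H = "insert [] ((\<lambda>i. [0, i]) ` {..<3 :: nat})"
    and ?U = "\<lambda>v. if v = [] then {} else \<Union>j\<in>{..<3}. (\<lambda>w. v @ j # w) ` high_tree k"
  have "lmw_le word_adj (insert [0] (\<Union>v\<in>?H. insert v (?U v))) (Suc k)"
  proof (rule lmw_le_star)
    fix v assume v: "v \<in> ?H"
    have "lmw_le word_adj (\<Union>j\<in>{..<3}. (\<lambda>w. 0 # i # j # w) ` high_tree k) k" for i
      using Suc by (intro lmw_le_UN) (auto simp: lmw_le_copy inj_def)
    then show "lmw_le word_adj (?U v) k" using v by auto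
  qed (auto split: if_splits)
  moreover have "insert [0] (\<Union>v\<in>?H. insert v (?U v)) = high_tree (Suc k)" by auto
  ultimately show ?case by metis
qed

definition high_copies :: "nat \<Rightarrow> nat \<Rightarrow> nat list set" where
  "high_copies k i = (\<Union>j\<in>{..<3}. (\<lambda>w. 0 # i # j # w) ` high_tree k)"

text \<open>The roots of the copies are too close to each other in the square, so the width of a
  copy has to be attained without its root.\<close>

lemma not_lmw_square_high_copies:
  assumes "k = Suc k' \<Longrightarrow> \<not> lmw_le (square word_adj) (high_tree k - {[]}) (Suc (2 * k'))"
    and "k = 0 \<or> k = Suc k'"
  shows "\<not> lmw_le (square word_adj) (high_copies k i) (2 * k)"
  using assms(2)
proof
  assume "k = 0"
  \<comment> \<open>The copies are single vertices here; two of them have a common neighbour and so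
    form an edge of the square.\<close>
  moreover have "\<not> lmw_le (square word_adj) (high_copies 0 i) 0"
    by (rule not_lmw_le_0[of "[0, i, 0]" _ "[0, i, 1]"]) (auto simp: high_copies_def)
  ultimately show ?thesis by simp
next
  assume k: "k = Suc k'"
  let ?f = "\<lambda>j w. 0 # i # j # w"
  have "\<not> lmw_le (square word_adj) (high_copies k i) (Suc (Suc (2 * k')))"
  proof (rule not_lmw_le_Suc[of _ "\<lambda>j. ?f j ` (high_tree k - {[]})"])
    show "\<not> lmw_le (square word_adj) (?f j ` (high_tree k - {[]})) (Suc (2 * k'))" for j
      using assms(1)[OF k] by (subst lmw_le_copy) (auto simp: inj_def)
    show "?f j ` (high_tree k - {[]}) \<subseteq> high_copies k i" if "j < 3" for j
      using that by (auto simp: high_copies_def)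
    fix j l m :: nat assume jlm: "j < 3" "l < 3" "m < 3" "j \<noteq> l" "j \<noteq> m" "l \<noteq> m"
    \<comment> \<open>The roots of the two copies are adjacent in the square through
      \<open>[0, i]\<close>. Both copies have distance at least three from the remaining one without
      its root.\<close>
    let ?D = "?f l ` high_tree k \<union> ?f m ` high_tree k"
    have "conn (square word_adj) (?f j ` high_tree k)" for j
      by (rule conn_image[OF conn_square_word_adj[OF conn_high_tree]]) simp
    then have "conn (square word_adj) ?D"
      using jlm by (intro conn_Un[of _ _ _ "[0, i, l]" "[0, i, m]"]) auto
    moreover have "?D \<subseteq> high_copies k i" using jlm by (auto simp: high_copies_def)
    moreover have "\<forall>a\<in>?D. \<forall>b\<in>?f j ` (high_tree k - {[]}). a \<noteq> b \<and> \<not> square word_adj a b"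
      using jlm by auto
    ultimately show "\<exists>D. ?f l ` (high_tree k - {[]}) \<subseteq> D \<and> ?f m ` (high_tree k - {[]}) \<subseteq> D \<and>
        D \<subseteq> high_copies k i \<and> conn (square word_adj) D \<and>
        (\<forall>a\<in>D. \<forall>b\<in>?f j ` (high_tree k - {[]}). a \<noteq> b \<and> \<not> square word_adj a b)"
      by (intro exI[of _ ?D]) auto
  qed (rule symp_square_word_adj)
  then show ?thesis using k by simp
qed

text \<open>Each level gains two: once among the three copies at \<open>[0, i]\<close>, by
  \<open>not_lmw_square_high_copies\<close>, and once among the three groups around the centre, in
  \<open>step\<close>. The root is removed because the next level can use the copies only without
  their roots.\<close>

lemma not_lmw_square_high_tree:
  "\<not> lmw_le (square word_adj) (high_tree (Suc k) - {[]}) (Suc (2 * k))"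
proof (induction k)
  have step: "\<not> lmw_le (square word_adj) (high_tree (Suc k) - {[]}) (Suc (2 * k))"
    if wide: "\<And>i. \<not> lmw_le (square word_adj) (high_copies k i) (2 * k)" for k
  proof (rule not_lmw_le_Suc[of _ "high_copies k"])
    show "\<not> lmw_le (square word_adj) (high_copies k i) (2 * k)" for i by (rule wide)
    show "high_copies k i \<subseteq> high_tree (Suc k) - {[]}" if "i < 3" for i
      using that by (auto simp: high_copies_def)
    fix i j l :: nat assume ijl: "i < 3" "j < 3" "l < 3" "i \<noteq> j" "i \<noteq> l" "j \<noteq> l"
    \<comment> \<open>The vertices \<open>[0, j]\<close> and \<open>[0, l]\<close> are adjacent in
      the square through the centre and have distance three from the roots of the copies in group
      \<open>i\<close>.\<close>
    let ?D = "insert [0, j] (high_copies k j) \<union> insert [0, l] (high_copies k l)"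
    have "conn (square word_adj) (insert [0, j] (high_copies k j))" for j
      unfolding high_copies_def
      by (intro conn_square_word_adj conn_high_block conn_high_tree) simp
    then have "conn (square word_adj) ?D"
      using ijl by (intro conn_Un[of _ _ _ "[0, j]" "[0, l]"]) auto
    moreover have "?D \<subseteq> high_tree (Suc k) - {[]}" using ijl by (auto simp: high_copies_def)
    moreover have "\<forall>a\<in>?D. \<forall>b\<in>high_copies k i. a \<noteq> b \<and> \<not> square word_adj a b"
      using ijl by (auto simp: high_copies_def)
    ultimately show "\<exists>D. high_copies k j \<subseteq> D \<and> high_copies k l \<subseteq> D \<and>
        D \<subseteq> high_tree (Suc k) - {[]} \<and> conn (square word_adj) D \<and>
        (\<forall>a\<in>D. \<forall>b\<in>high_copies k i. a \<noteq> b \<and> \<not> square word_adj a b)"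
      by - (intro exI[of _ ?D] conjI, (assumption | blast)+)
  qed (rule symp_square_word_adj)
  {
    case 0
    show ?case by (intro step not_lmw_square_high_copies[of 0 0]) auto
  next
    case (Suc k)
    show ?case by (rule step, rule not_lmw_square_high_copies[OF Suc]) simp
  }
qed

section \<open>The bounds for trees and their sharpness\<close>

lemma tree_lmw_square_bounds:
  assumes "is_tree V E"
  shows "lmw V E \<le> lmw V (graph_square V E)" "lmw V (graph_square V E) \<le> 2 * lmw V E"
proof -
  have simple: "simple_graph V E" using assms by (simp add: is_tree_def)
  then have fin: "finite V" by (rule simple_graph_finite)
  have square: "lmw V (graph_square V E) \<le> k \<longleftrightarrow> lmw_le (square (adj E)) V k" for k
    using lmw_le_iff[OF simple_graph_square[OF fin]] adj_graph_square[OF simple] by metis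
  have "lmw_le (square (adj E)) V (lmw V (graph_square V E))" using square by blast
  then have "lmw_le (adj E) V (lmw V (graph_square V E))"
    by (rule forest.lmw_le_of_square[OF is_tree_imp_forest[OF assms] is_tree_imp_conn[OF assms] fin])
  then show "lmw V E \<le> lmw V (graph_square V E)" using lmw_le_iff[OF simple] by blast
  have "lmw_le (adj E) V (lmw V E)" using lmw_le_iff[OF simple] by blast
  then have "lmw_le (square (adj E)) V (2 * lmw V E)"
    using simple_graph_adj(2)[OF simple] by (rule lmw_le_square[OF symp_adj])
  then show "lmw V (graph_square V E) \<le> 2 * lmw V E" using square by blast
qed

lemma lower_bound_tight:
  "\<exists>(V :: nat set) E. is_tree V E \<and> lmw V E = k \<and> lmw V (graph_square V E) = k"
proof -
  let ?V = "list_encode ` low_tree k" and ?E = "edges_on list_encode (low_tree k) word_adj"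
  have "low_tree k \<noteq> {}" using Nil_in_low_tree by blast
  note tree = forest.tree_of_forest[OF forest_word_adj inj_list_encode finite_low_tree this conn_low_tree]
  \<comment> \<open>Width at most \<open>k - 1\<close> is refuted for positive \<open>k\<close>; for
    \<open>k = 0\<close> the bound is trivial.\<close>
  have "k \<le> lmw ?V ?E"
    using tree(2)[of "k - 1"] not_lmw_low_tree[of "k - 1"] by (cases k) auto
  then show ?thesis
    using tree(1) tree_lmw_square_bounds(1)[OF tree(1)] tree(3)[of k] lmw_square_low_tree[of k]
    by (intro exI[of _ ?V] exI[of _ ?E]) auto
qed

lemma upper_bound_tight:
  "\<exists>(V :: nat set) E. is_tree V E \<and> lmw V E = k \<and> lmw V (graph_square V E) = 2 * k"
proof -
  let ?V = "list_encode ` high_tree k" and ?E = "edges_on list_encode (high_tree k) word_adj"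
  have "high_tree k \<noteq> {}" using Nil_in_high_tree by blast
  note tree = forest.tree_of_forest[OF forest_word_adj inj_list_encode finite_high_tree this conn_high_tree]
  have "2 * k \<le> lmw ?V (graph_square ?V ?E)"
  proof (cases k)
    case (Suc j)
    \<comment> \<open>With \<open>k = Suc j\<close>, the excluded value \<open>Suc (2 * j)\<close>
      is \<open>2 * k - 1\<close>, and restoring the root cannot lower the width.\<close>
    then have "\<not> lmw_le (square word_adj) (high_tree k) (Suc (2 * j))"
      using not_lmw_square_high_tree lmw_le_subset by (metis Diff_subset)
    then show ?thesis using tree(3)[of "Suc (2 * j)"] Suc by simp
  qed simp
  then show ?thesis
    using tree(1) tree_lmw_square_bounds(2)[OF tree(1)] tree(2)[of k] lmw_high_tree[of k]
    by (intro exI[of _ ?V] exI[of _ ?E]) auto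
qed

theorem theorem1:
  shows "(\<forall>(V :: 'a set) E k. is_tree V E \<and> lmw V E = k \<longrightarrow>
            k \<le> lmw V (graph_square V E) \<and> lmw V (graph_square V E) \<le> 2 * k) \<and>
         (\<forall>k :: nat.
            (\<exists>(V :: nat set) E. is_tree V E \<and> lmw V E = k \<and> lmw V (graph_square V E) = k) \<and>
            (\<exists>(V :: nat set) E. is_tree V E \<and> lmw V E = k \<and> lmw V (graph_square V E) = 2 * k))"
  using tree_lmw_square_bounds lower_bound_tight upper_bound_tight by blast

end
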